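(* Let $\alpha \in (0,1]$. There is a constant $L_0 = L_0(K_0,K_1,M_0,\alpha) > 0$ such that the following holds whenever $\{L_n\}_{n\ge 1}$ is nondecreasing with $L_1 \geq L_0$. Let $\phi : \mathbb{T}^2 \to \mathbb{R}$ be $\alpha$-Hölder continuous with $\int \phi \, d\mathrm{Leb}_{\mathbb{T}^2} = 0$. (a) If $N^2 L_N^{-\frac{\alpha}{3\alpha+4}} \to 0$ as $N\to\infty$, then $\frac1N \sum_{i=0}^N \phi \circ F^i \to 0$ in $L^2$ (with respect to $\mathrm{Leb}_{\mathbb{T}^2}$). (b) If $N^{4+\epsilon} L_N^{-\frac{\alpha}{3\alpha+4}} \to 0$ as $N\to\infty$ for some $\epsilon > 0$, then $\frac1N \sum_{i=0}^N \phi \circ F^i \to 0$ Lebesgue almost everywhere.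
   Context: Setting. $\mathbb{T}^1 = \mathbb{R}/\mathbb{Z}$ is parametrized by $[0,1)$, $\mathbb{T}^2 = \mathbb{R}^2/\mathbb{Z}^2$ carries the flat metric, and $d$ denotes geodesic distance. Fix constants $M_0 \in \mathbb{N}$, $K_0, K_1 > 0$, and a nondecreasing sequence $\{L_n\}_{n \geq 1}$ of positive reals. For each $n \geq 1$ let $f_n : \mathbb{T}^1 \to \mathbb{R}$ be a $C^3$ function such that: (i) $\|f_n'\|_{C^0} + \|f_n''\|_{C^0} \leq K_0 L_n$; (ii) $\mathcal{C}_n := \{\hat x \in \mathbb{T}^1 : f_n'(\hat x) = 0\}$ is finite with cardinality $\leq M_0$; (iii) $|f_n'(x)| \geq L_n K_1^{-1} d(x, \mathcal{C}_n)$ for all $x \in \mathbb{T}^1$. Define $F_n : \mathbb{T}^2 \to \mathbb{T}^2$ by $F_n(x,y) = (f_n(x) - y \ (\mathrm{mod}\ 1),\, x)$, and set $F^n = F_n \circ F_{n-1} \circ \cdots \circ F_1$ for $n \geq 1$, $F^0 = \mathrm{Id}$. *)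

theory Defs
  imports "HOL-Analysis.Analysis"
begin

text \<open>Points of the tori \<open>\<real>/\<int>\<close> and \<open>\<real>\<^sup>2/\<int>\<^sup>2\<close> are represented by their representatives in
  \<open>[0,1)\<close> and \<open>[0,1)\<^sup>2\<close>; real-valued functions on the tori are represented by their periodic
  lifts to \<open>\<real>\<close> and \<open>\<real>\<^sup>2\<close>.\<close>

definition T1 :: "real set" where
  "T1 = {0..<1}"

definition T2 :: "(real \<times> real) set" where
  "T2 = T1 \<times> T1"

definition Leb_T2 :: "(real \<times> real) measure" where
  "Leb_T2 = restrict_space lborel T2"

text \<open>The geodesic distance of the flat quotient metric is the distance from one lift to the set of
  all lifts of the other point. As functions of the lifts these are pseudometrics.\<close>

definition dist_T1 :: "real \<Rightarrow> real \<Rightarrow> real" where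
  "dist_T1 x y = infdist x (range (\<lambda>k::int. y + of_int k))"

definition dist_T2 :: "real \<times> real \<Rightarrow> real \<times> real \<Rightarrow> real" where
  "dist_T2 p q = infdist p (range (\<lambda>(k::int, l::int). q + (of_int k, of_int l)))"

definition setdist_T1 :: "real \<Rightarrow> real set \<Rightarrow> real" where
  "setdist_T1 x A = (INF a\<in>A. dist_T1 x a)"

definition periodic1 :: "(real \<Rightarrow> real) \<Rightarrow> bool" where
  "periodic1 g \<longleftrightarrow> (\<forall>x. g (x + 1) = g x)"

definition C_diff :: "nat \<Rightarrow> (real \<Rightarrow> real) \<Rightarrow> bool" where
  "C_diff k g \<longleftrightarrow> (\<forall>j<k. \<forall>x. (deriv ^^ j) g differentiable (at x)) \<and>
     continuous_on UNIV ((deriv ^^ k) g)"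

definition C0_norm :: "(real \<Rightarrow> real) \<Rightarrow> real" where
  "C0_norm g = (SUP x\<in>T1. \<bar>g x\<bar>)"

definition crit_set :: "(real \<Rightarrow> real) \<Rightarrow> real set" where
  "crit_set g = {x \<in> T1. deriv g x = 0}"

text \<open>The standing conditions on a single map with parameter \<open>l\<close>. A periodic differentiable
  function has a critical point by Rolle's theorem, so the infimum in \<open>setdist_T1\<close> is taken over
  a nonempty set; periodicity and continuity make both suprema in \<open>C0_norm\<close> finite.\<close>

definition admissible :: "real \<Rightarrow> real \<Rightarrow> nat \<Rightarrow> real \<Rightarrow> (real \<Rightarrow> real) \<Rightarrow> bool" where
  "admissible K0 K1 M0 l g \<longleftrightarrow>
     periodic1 g \<and> C_diff 3 g \<and>
     C0_norm (deriv g) + C0_norm (deriv (deriv g)) \<le> K0 * l \<and>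
     finite (crit_set g) \<and> card (crit_set g) \<le> M0 \<and>
     (\<forall>x\<in>T1. \<bar>deriv g x\<bar> \<ge> l * inverse K1 * setdist_T1 x (crit_set g))"

definition torus_map :: "(real \<Rightarrow> real) \<Rightarrow> real \<times> real \<Rightarrow> real \<times> real" where
  "torus_map g = (\<lambda>(x, y). (frac (g x - y), x))"

primrec comp_map :: "(nat \<Rightarrow> real \<Rightarrow> real) \<Rightarrow> nat \<Rightarrow> real \<times> real \<Rightarrow> real \<times> real" where
  "comp_map f 0 = id"
| "comp_map f (Suc n) = torus_map (f (Suc n)) \<circ> comp_map f n"

text \<open>Since \<open>dist_T2\<close> vanishes on pairs of lifts of the same point, this condition includes
  \<open>\<int>\<^sup>2\<close>-periodicity of \<open>\<phi>\<close>.\<close>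

definition Holder_T2 :: "real \<Rightarrow> (real \<times> real \<Rightarrow> real) \<Rightarrow> bool" where
  "Holder_T2 \<alpha> \<phi> \<longleftrightarrow> (\<exists>C. \<forall>p q. \<bar>\<phi> p - \<phi> q\<bar> \<le> C * dist_T2 p q powr \<alpha>)"

definition birkhoff_avg ::
  "(nat \<Rightarrow> real \<Rightarrow> real) \<Rightarrow> (real \<times> real \<Rightarrow> real) \<Rightarrow> nat \<Rightarrow> real \<times> real \<Rightarrow> real" where
  "birkhoff_avg f \<phi> N p = (1 / real N) * (\<Sum>i=0..N. \<phi> (comp_map f i p))"

definition tendsto_L2 :: "'a measure \<Rightarrow> (nat \<Rightarrow> 'a \<Rightarrow> real) \<Rightarrow> ('a \<Rightarrow> real) \<Rightarrow> bool" where
  "tendsto_L2 M g h \<longleftrightarrow>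
     h \<in> borel_measurable M \<and> integrable M (\<lambda>x. (h x)\<^sup>2) \<and>
     (\<forall>n. g n \<in> borel_measurable M \<and> integrable M (\<lambda>x. (g n x)\<^sup>2)) \<and>
     (\<lambda>n. sqrt (\<integral>x. (g n x - h x)\<^sup>2 \<partial>M)) \<longlonglongrightarrow> 0"

end

theory Submission
  imports Defs
begin

text \<open>
  Write \<open>(x\<^sub>n, x\<^sub>n\<^sub>-\<^sub>1)\<close> for the \<open>n\<close>-th point of an orbit, lifted to the plane, so that
  \<open>x\<^sub>k = f\<^sub>k (x\<^sub>k\<^sub>-\<^sub>1) - x\<^sub>k\<^sub>-\<^sub>2\<close> with initial point \<open>(x, y)\<close>. The parameters grow so fast that the whole
  theorem reduces to decay of correlations of the characters \<open>cos (2 \<pi> (a x + b y) + \<theta>)\<close> of the torus,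
  at a rate that does not depend on the time gap.

  \<^emph>\<open>Decay of correlations.\<close> All maps preserve Lebesgue measure (\<open>distr_comp_map\<close>), so the correlation
  of a character at times \<open>i\<close> and \<open>i + n\<close> is one of the shifted sequence of maps at times \<open>0\<close> and \<open>n\<close>.
  The product of the two cosines is a sum of cosines of phases
  \<open>\<Phi> = 2 \<pi> (a x\<^sub>n + b x\<^sub>n\<^sub>-\<^sub>1 + a' x + b' y) + \<theta>\<close>. Fix \<open>y\<close> and differentiate in \<open>x\<close>. As long as the
  orbit stays where \<open>\<bar>f\<^sub>k'\<bar> \<ge> \<lambda>\<^sub>k\<close> with large \<open>\<lambda>\<^sub>k\<close>, the derivatives \<open>x\<^sub>k'\<close> grow by a factor
  \<open>\<lambda>\<^sub>k / 2\<close> in each step (\<open>jacobi_growth\<close>), while \<open>\<bar>x\<^sub>k''\<bar> \<le> c \<bar>x\<^sub>k'\<bar>\<^sup>2\<close> for a small \<open>c\<close>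
  (\<open>jacobi2_bound\<close>). This is exactly what is needed to integrate
  \<open>\<chi> cos \<Phi> = (\<chi> / \<Phi>') (sin \<Phi>)'\<close> by parts, where \<open>\<chi>\<close> is a differentiable cutoff to the good orbits: the
  result is of order \<open>c\<close> (\<open>oscillation\<close>). The discarded part \<open>1 - \<chi>\<close> is at most the sum over \<open>k\<close> of the
  probability that \<open>\<bar>f\<^sub>k'\<bar> < 2 \<lambda>\<^sub>k\<close>, and by invariance and the lower bound on \<open>\<bar>f\<^sub>k'\<bar>\<close> this is a
  neighbourhood of the critical points of size \<open>\<lambda>\<^sub>k / L\<^sub>k\<close> (\<open>measure_near_critical\<close>). With
  \<open>\<lambda>\<^sub>k = L\<^sub>k\<^sup>3\<^sup>/\<^sup>4\<close> everything is bounded by a multiple of \<open>\<Sum>\<^sub>k L\<^sub>k\<^sup>-\<^sup>1\<^sup>/\<^sup>4\<close>, the sum ranging over the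
  times after \<open>i\<close>.

  \<^emph>\<open>Law of large numbers.\<close> Since \<open>\<alpha> / (3 \<alpha> + 4) \<le> 1 / 7\<close>, the hypothesis of (a) forces \<open>L\<^sub>k\<^sup>1\<^sup>/\<^sup>4 \<ge> k\<^sup>3\<close>
  for large \<open>k\<close>, so the correlations at times \<open>i + 2 \<le> j\<close> are \<open>O(i\<^sup>-\<^sup>2)\<close>. Hence the second moment of
  the \<open>N\<close>-th Birkhoff sum grows at most linearly, the averages converge to \<open>0\<close> almost everywhere
  along the squares, and boundedness fills the gaps between squares.

  \<^emph>\<open>General observables.\<close> A continuous periodic function is a uniform limit of trigonometric
  polynomials by the Stone--Weierstrass theorem, and almost everywhere convergence passes to uniform
  limits without any rate. Since the hypothesis of (b) implies that of (a), this proves (b); and (a)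
  follows from almost everywhere convergence by dominated convergence.
\<close>

section \<open>Invariance of Lebesgue measure\<close>

lemma sets_T1 [measurable]: "T1 \<in> sets borel"
  by (simp add: T1_def)

lemma sets_T2 [measurable]: "T2 \<in> sets borel"
  unfolding T2_def borel_prod[symmetric] by measurable

lemma space_Leb_T2 [simp]: "space Leb_T2 = T2"
  by (simp add: Leb_T2_def space_restrict_space)

lemma measurable_Leb_T2: "h \<in> borel_measurable borel \<Longrightarrow> h \<in> borel_measurable Leb_T2"
  unfolding Leb_T2_def by (rule measurable_restrict_space1) simp

lemma emeasure_T1: "emeasure lborel T1 = 1"
  by (simp add: T1_def)

lemma nn_integral_Leb_T2:
  fixes h :: "real \<times> real \<Rightarrow> ennreal"
  assumes [measurable]: "h \<in> borel_measurable borel"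
  shows "integral\<^sup>N Leb_T2 h
    = (\<integral>\<^sup>+y. (\<integral>\<^sup>+x. h (x, y) * indicator T1 x \<partial>lborel) * indicator T1 y \<partial>lborel)"
    and "integral\<^sup>N Leb_T2 h
    = (\<integral>\<^sup>+x. (\<integral>\<^sup>+y. h (x, y) * indicator T1 y \<partial>lborel) * indicator T1 x \<partial>lborel)"
proof -
  have hm [measurable]: "h \<in> borel_measurable (borel \<Otimes>\<^sub>M borel)"
    by (simp add: borel_prod)
  have meas: "(\<lambda>p. h p * indicator T2 p) \<in> borel_measurable (lborel \<Otimes>\<^sub>M lborel)"
    by (simp add: lborel_prod)
  have eq: "integral\<^sup>N Leb_T2 h = integral\<^sup>N (lborel \<Otimes>\<^sub>M lborel) (\<lambda>p. h p * indicator T2 p)"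
    unfolding Leb_T2_def lborel_prod by (rule nn_integral_restrict_space) simp
  have ind: "h (x, y) * indicator T2 (x, y) = h (x, y) * indicator T1 x * indicator T1 y" for x y
    by (simp add: T2_def indicator_def)
  have "integral\<^sup>N Leb_T2 h = (\<integral>\<^sup>+y. (\<integral>\<^sup>+x. h (x, y) * indicator T1 x * indicator T1 y \<partial>lborel) \<partial>lborel)"
    unfolding eq lborel_pair.nn_integral_snd[OF meas, symmetric] ind ..
  also have "\<dots> = (\<integral>\<^sup>+y. (\<integral>\<^sup>+x. h (x, y) * indicator T1 x \<partial>lborel) * indicator T1 y \<partial>lborel)"
    by (intro nn_integral_cong nn_integral_multc) simp
  finally show "integral\<^sup>N Leb_T2 h
    = (\<integral>\<^sup>+y. (\<integral>\<^sup>+x. h (x, y) * indicator T1 x \<partial>lborel) * indicator T1 y \<partial>lborel)" .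
  have "integral\<^sup>N Leb_T2 h = (\<integral>\<^sup>+x. (\<integral>\<^sup>+y. h (x, y) * indicator T1 y * indicator T1 x \<partial>lborel) \<partial>lborel)"
    unfolding eq lborel.nn_integral_fst[OF meas, symmetric] ind by (simp add: mult_ac)
  also have "\<dots> = (\<integral>\<^sup>+x. (\<integral>\<^sup>+y. h (x, y) * indicator T1 y \<partial>lborel) * indicator T1 x \<partial>lborel)"
    by (intro nn_integral_cong nn_integral_multc) simp
  finally show "integral\<^sup>N Leb_T2 h
    = (\<integral>\<^sup>+x. (\<integral>\<^sup>+y. h (x, y) * indicator T1 y \<partial>lborel) * indicator T1 x \<partial>lborel)" .
qed

lemma emeasure_Leb_T2: "emeasure Leb_T2 T2 = 1"
proof -
  have "emeasure Leb_T2 (space Leb_T2) = integral\<^sup>N Leb_T2 (\<lambda>_. 1)"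
    by simp
  also have "\<dots> = 1"
    by (subst nn_integral_Leb_T2) (simp_all add: emeasure_T1)
  finally show ?thesis by simp
qed

lemma finite_measure_Leb_T2: "finite_measure Leb_T2"
  by (rule finite_measureI) (simp add: emeasure_Leb_T2)

lemma measure_Leb_T2: "measure Leb_T2 T2 = 1"
  by (simp add: measure_def emeasure_Leb_T2)

lemma borel_measurable_frac [measurable]: "(frac :: real \<Rightarrow> real) \<in> borel_measurable borel"
  unfolding frac_def by measurable

text \<open>The reflection \<open>y \<mapsto> c - y\<close> of the circle acts on \<open>[0,1)\<close> as two reflections, exchanging the ends of
  \<open>[0, frac c]\<close> and of \<open>(frac c, 1)\<close>.\<close>

lemma nn_integral_T1_reflect:
  fixes h :: "real \<Rightarrow> ennreal" and c :: real
  assumes [measurable]: "h \<in> borel_measurable borel"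
  shows "(\<integral>\<^sup>+y. h (frac (c - y)) * indicator T1 y \<partial>lborel) = (\<integral>\<^sup>+y. h y * indicator T1 y \<partial>lborel)"
proof -
  define r where "r = frac c"
  have r: "0 \<le> r" "r < 1" by (simp_all add: r_def frac_lt_1)
  have fr: "frac (c - y) = frac (r - y)" for y
  proof -
    have "r - y = (c - y) - of_int \<lfloor>c\<rfloor>"
      by (simp add: r_def frac_def)
    then show ?thesis
      unfolding frac_def by (simp only: floor_diff_of_int of_int_diff)
  qed
  have le: "frac (r - y) = r - y" if "0 \<le> y" "y \<le> r" for y
    using that r by (subst frac_eq) auto
  have gt: "frac (r - y) = r + 1 - y" if "r < y" "y < 1" for y
  proof -
    have "r - y - (r + 1 - y) = of_int (- 1)" by simp
    then have "r - y - (r + 1 - y) \<in> \<int>" by (simp only: Ints_of_int)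
    then show ?thesis
      using that r by (subst frac_unique_iff) auto
  qed
  have "(\<integral>\<^sup>+y. h (frac (c - y)) * indicator T1 y \<partial>lborel)
      = (\<integral>\<^sup>+y. h (r - y) * indicator {0..r} y + h (r + 1 - y) * indicator {r<..<1} y \<partial>lborel)"
    using r by (intro nn_integral_cong) (auto simp: fr le gt T1_def indicator_def)
  also have "\<dots> = (\<integral>\<^sup>+y. h (r - y) * indicator {0..r} y \<partial>lborel)
      + (\<integral>\<^sup>+y. h (r + 1 - y) * indicator {r<..<1} y \<partial>lborel)"
    by (intro nn_integral_add) auto
  also have "(\<integral>\<^sup>+y. h (r - y) * indicator {0..r} y \<partial>lborel) = (\<integral>\<^sup>+y. h y * indicator {0..r} y \<partial>lborel)"
    by (subst (2) nn_integral_real_affine[where c = "-1" and t = r])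
       (auto intro!: nn_integral_cong simp: indicator_def)
  also have "(\<integral>\<^sup>+y. h (r + 1 - y) * indicator {r<..<1} y \<partial>lborel)
      = (\<integral>\<^sup>+y. h y * indicator {r<..<1} y \<partial>lborel)"
    by (subst (2) nn_integral_real_affine[where c = "-1" and t = "r + 1"])
       (auto intro!: nn_integral_cong simp: indicator_def)
  also have "(\<integral>\<^sup>+y. h y * indicator {0..r} y \<partial>lborel) + (\<integral>\<^sup>+y. h y * indicator {r<..<1} y \<partial>lborel)
      = (\<integral>\<^sup>+y. h y * indicator {0..r} y + h y * indicator {r<..<1} y \<partial>lborel)"
    by (intro nn_integral_add[symmetric]) auto
  also have "\<dots> = (\<integral>\<^sup>+y. h y * indicator T1 y \<partial>lborel)"
    using r by (intro nn_integral_cong) (auto simp: T1_def indicator_def)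
  finally show ?thesis .
qed

lemma torus_map_in_T2: "p \<in> T2 \<Longrightarrow> torus_map g p \<in> T2"
  by (auto simp: T2_def T1_def torus_map_def frac_lt_1)

lemma measurable_torus_map_borel:
  assumes [measurable]: "g \<in> borel_measurable borel"
  shows "torus_map g \<in> borel_measurable borel"
  unfolding torus_map_def borel_prod[symmetric] by measurable

lemma measurable_torus_map:
  assumes "g \<in> borel_measurable borel"
  shows "torus_map g \<in> measurable Leb_T2 Leb_T2"
  unfolding Leb_T2_def
  by (rule measurable_restrict_space3)
     (auto simp: torus_map_in_T2 measurable_torus_map_borel[OF assms])

text \<open>For fixed \<open>x\<close>, the first coordinate of the image is a reflection of the circle in \<open>y\<close>, and the second
  is \<open>x\<close> itself. So Tonelli's theorem reduces invariance to the one-dimensional reflection, after which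
  the two coordinates have exchanged their roles.\<close>

lemma distr_torus_map:
  assumes [measurable]: "g \<in> borel_measurable borel"
  shows "distr Leb_T2 Leb_T2 (torus_map g) = Leb_T2"
proof (rule measure_eqI)
  fix A assume "A \<in> sets (distr Leb_T2 Leb_T2 (torus_map g))"
  then have A: "A \<in> sets Leb_T2" by simp
  then have A': "A \<in> sets borel"
    unfolding Leb_T2_def by (subst (asm) sets_restrict_space_iff) auto
  then have [measurable]: "A \<in> sets (borel \<Otimes>\<^sub>M borel)"
    by (simp only: borel_prod)
  note [measurable] = measurable_torus_map_borel[OF assms]
  have "emeasure (distr Leb_T2 Leb_T2 (torus_map g)) A
      = integral\<^sup>N (distr Leb_T2 Leb_T2 (torus_map g)) (indicator A)"
    using A by simp
  also have "\<dots> = (\<integral>\<^sup>+p. indicator A (torus_map g p) \<partial>Leb_T2)"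
    using A by (subst nn_integral_distr) (simp_all add: measurable_torus_map)
  also have "\<dots> = (\<integral>\<^sup>+x. (\<integral>\<^sup>+y. indicator A (frac (g x - y), x) * indicator T1 y \<partial>lborel)
      * indicator T1 x \<partial>lborel)"
    using A' by (subst nn_integral_Leb_T2(2)) (simp, simp add: torus_map_def)
  also have "\<dots> = (\<integral>\<^sup>+x. (\<integral>\<^sup>+y. indicator A (y, x) * indicator T1 y \<partial>lborel)
      * indicator T1 x \<partial>lborel)"
    by (intro nn_integral_cong arg_cong2[where f = "(*)"] refl
          nn_integral_T1_reflect[where h = "\<lambda>z. indicator A (z, _)"]) measurable
  also have "\<dots> = integral\<^sup>N Leb_T2 (indicator A)"
    using A' by (subst nn_integral_Leb_T2(1)) auto
  finally show "emeasure (distr Leb_T2 Leb_T2 (torus_map g)) A = emeasure Leb_T2 A"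
    using A by simp
qed simp

lemma measurable_comp_map:
  assumes "\<And>k. k \<ge> 1 \<Longrightarrow> f k \<in> borel_measurable borel"
  shows "comp_map f n \<in> measurable Leb_T2 Leb_T2"
proof (induction n)
  case (Suc n)
  then show ?case
    unfolding comp_map.simps by (rule measurable_comp) (simp add: measurable_torus_map assms)
qed (simp add: id_def)

lemma distr_comp_map:
  assumes "\<And>k. k \<ge> 1 \<Longrightarrow> f k \<in> borel_measurable borel"
  shows "distr Leb_T2 Leb_T2 (comp_map f n) = Leb_T2"
proof (induction n)
  case (Suc n)
  have "distr Leb_T2 Leb_T2 (comp_map f (Suc n))
      = distr (distr Leb_T2 Leb_T2 (comp_map f n)) Leb_T2 (torus_map (f (Suc n)))"
    unfolding comp_map.simps
    by (rule distr_distr[symmetric]) (simp_all add: measurable_comp_map measurable_torus_map assms)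
  then show ?case
    by (simp add: Suc distr_torus_map assms del: comp_map.simps)
qed (simp add: id_def distr_id)

lemma integral_comp_map:
  fixes \<psi> :: "real \<times> real \<Rightarrow> real"
  assumes "\<And>k. k \<ge> 1 \<Longrightarrow> f k \<in> borel_measurable borel" and "\<psi> \<in> borel_measurable Leb_T2"
  shows "(\<integral>p. \<psi> (comp_map f n p) \<partial>Leb_T2) = (\<integral>p. \<psi> p \<partial>Leb_T2)"
  using integral_distr[OF measurable_comp_map, of f \<psi> n] assms by (simp add: distr_comp_map)

lemma comp_map_in_T2: "p \<in> T2 \<Longrightarrow> comp_map f n p \<in> T2"
  by (induction n) (auto simp: torus_map_in_T2)

text \<open>The maps after time \<open>i\<close> are again a composition of the same kind. With invariance this moves every
  correlation to the initial time.\<close>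

lemma comp_map_add: "comp_map (\<lambda>k. f (k + i)) n (comp_map f i p) = comp_map f (n + i) p"
  by (induction n) simp_all

section \<open>Growth of derivatives along lifted orbits\<close>

text \<open>The lift of the orbit of \<open>(x, y)\<close>, as one sequence: the state after \<open>n\<close> steps is the pair of the values at
  \<open>Suc n\<close> and \<open>n\<close>, so the index is shifted by one against time.\<close>

fun orbit_lift :: "(nat \<Rightarrow> real \<Rightarrow> real) \<Rightarrow> real \<Rightarrow> real \<Rightarrow> nat \<Rightarrow> real" where
  "orbit_lift f x y 0 = y"
| "orbit_lift f x y (Suc 0) = x"
| "orbit_lift f x y (Suc (Suc k)) = f (Suc k) (orbit_lift f x y (Suc k)) - orbit_lift f x y k"

text \<open>The derivative of \<open>orbit_lift\<close> in \<open>x\<close>, with \<open>g k\<close> in place of the slope of \<open>f k\<close> along the orbit. Abstracting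
  from the orbit makes the growth estimates statements on recursive sequences of numbers.\<close>

fun jacobi :: "(nat \<Rightarrow> real) \<Rightarrow> nat \<Rightarrow> real" where
  "jacobi g 0 = 0"
| "jacobi g (Suc 0) = 1"
| "jacobi g (Suc (Suc k)) = g (Suc k) * jacobi g (Suc k) - jacobi g k"

text \<open>The second derivative of \<open>orbit_lift\<close> in \<open>x\<close>; \<open>s k\<close> stands for the second derivative of \<open>f k\<close> along the
  orbit.\<close>

fun jacobi2 :: "(nat \<Rightarrow> real) \<Rightarrow> (nat \<Rightarrow> real) \<Rightarrow> nat \<Rightarrow> real" where
  "jacobi2 g s 0 = 0"
| "jacobi2 g s (Suc 0) = 0"
| "jacobi2 g s (Suc (Suc k)) =
     s (Suc k) * (jacobi g (Suc k))\<^sup>2 + g (Suc k) * jacobi2 g s (Suc k) - jacobi2 g s k"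

abbreviation slope :: "(nat \<Rightarrow> real \<Rightarrow> real) \<Rightarrow> real \<Rightarrow> real \<Rightarrow> nat \<Rightarrow> real" where
  "slope f x y k \<equiv> deriv (f k) (orbit_lift f x y k)"

abbreviation bend :: "(nat \<Rightarrow> real \<Rightarrow> real) \<Rightarrow> real \<Rightarrow> real \<Rightarrow> nat \<Rightarrow> real" where
  "bend f x y k \<equiv> deriv (deriv (f k)) (orbit_lift f x y k)"

text \<open>The term \<open>jacobi g k\<close> in the recursion is dominated by \<open>jacobi g (Suc k)\<close> once the derivatives have
  started to grow, so it costs at most half of the factor \<open>lam\<close>. The three conclusions have to be proved
  together.\<close>

lemma jacobi_growth:
  fixes g lam :: "nat \<Rightarrow> real"
  assumes "\<And>k. 1 \<le> k \<Longrightarrow> k \<le> n \<Longrightarrow> 16 \<le> lam k \<and> lam k \<le> \<bar>g k\<bar>"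
  shows "k \<le> n \<Longrightarrow> \<bar>jacobi g k\<bar> \<le> \<bar>jacobi g (Suc k)\<bar>
           \<and> 1 \<le> \<bar>jacobi g (Suc k)\<bar>
           \<and> (1 \<le> k \<longrightarrow> lam k * \<bar>jacobi g k\<bar> \<le> 2 * \<bar>jacobi g (Suc k)\<bar>)"
proof (induction k)
  case (Suc k)
  define a where "a = \<bar>jacobi g (Suc k)\<bar>"
  have a: "\<bar>jacobi g k\<bar> \<le> a" "1 \<le> a"
    using Suc by (auto simp: a_def)
  have lam: "16 \<le> lam (Suc k)" "lam (Suc k) \<le> \<bar>g (Suc k)\<bar>"
    using assms[of "Suc k"] Suc.prems by auto
  have "lam (Suc k) * a \<le> \<bar>g (Suc k) * jacobi g (Suc k)\<bar>"
    unfolding abs_mult a_def using lam by (intro mult_right_mono) auto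
  then have step: "lam (Suc k) * a - a \<le> \<bar>jacobi g (Suc (Suc k))\<bar>"
    using a(1) by simp
  have "16 * a \<le> lam (Suc k) * a"
    using lam a by (intro mult_right_mono) auto
  with step a have "a \<le> \<bar>jacobi g (Suc (Suc k))\<bar>" "1 \<le> \<bar>jacobi g (Suc (Suc k))\<bar>"
      "lam (Suc k) * a \<le> 2 * \<bar>jacobi g (Suc (Suc k))\<bar>"
    by linarith+
  then show ?case by (simp only: a_def simp_thms)
qed simp

text \<open>The factor \<open>g k\<close> in the recursion has no upper bound. It is harmless because
  \<open>g k * jacobi g k = jacobi g (k + 1) + jacobi g (k - 1)\<close> is at most twice the next derivative, and the
  remaining factor \<open>jacobi g k\<close> is smaller than the next derivative by \<open>2 / lam k \<le> 1 / 8\<close>. So the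
  three terms of the recursion use up \<open>1/16\<close>, \<open>1/4\<close> and \<open>1/64\<close> of the bound.\<close>

lemma jacobi2_bound:
  fixes g s lam B :: "nat \<Rightarrow> real"
  assumes good: "\<And>k. 1 \<le> k \<Longrightarrow> k \<le> n \<Longrightarrow> 16 \<le> lam k \<and> lam k \<le> \<bar>g k\<bar>"
    and s: "\<And>k. 1 \<le> k \<Longrightarrow> k \<le> n \<Longrightarrow> \<bar>s k\<bar> \<le> B k"
    and B: "\<And>k. 1 \<le> k \<Longrightarrow> k \<le> n \<Longrightarrow> 64 * B k \<le> c * (lam k)\<^sup>2"
    and c: "0 \<le> c"
  shows "k \<le> Suc n \<Longrightarrow> \<bar>jacobi2 g s k\<bar> \<le> c * (jacobi g k)\<^sup>2"
proof (induction k rule: less_induct)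
  case (less k)
  consider "k = 0" | "k = 1" | j where "k = Suc (Suc j)"
    by (metis One_nat_def not0_implies_Suc)
  then show ?case
  proof cases
    case 3
    have j: "Suc j \<le> n" using less.prems 3 by simp
    define P0 P1 P2 l where "P0 = jacobi g j" and "P1 = jacobi g (Suc j)"
      and "P2 = jacobi g (Suc (Suc j))" and "l = lam (Suc j)"
    have l: "16 \<le> l" using good[of "Suc j"] j by (simp add: l_def)
    have P01: "\<bar>P0\<bar> \<le> \<bar>P1\<bar>" and P12: "\<bar>P1\<bar> \<le> \<bar>P2\<bar>" "l * \<bar>P1\<bar> \<le> 2 * \<bar>P2\<bar>"
      using jacobi_growth[of n lam g j] jacobi_growth[of n lam g "Suc j"] good j
      unfolding P0_def P1_def P2_def l_def by auto
    have sq: "(l * P1)\<^sup>2 \<le> 4 * P2\<^sup>2"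
      using power_mono[OF P12(2), of 2] l by (simp add: power_mult_distrib)
    have ih1: "\<bar>jacobi2 g s (Suc j)\<bar> \<le> c * P1\<^sup>2" and ih0: "\<bar>jacobi2 g s j\<bar> \<le> c * P0\<^sup>2"
      using less.IH[of "Suc j"] less.IH[of j] j 3 by (auto simp: P0_def P1_def)
    have "\<bar>s (Suc j) * P1\<^sup>2\<bar> \<le> B (Suc j) * P1\<^sup>2"
      using s[of "Suc j"] j by (simp add: abs_mult mult_right_mono)
    also have "\<dots> \<le> (c * l\<^sup>2 / 64) * P1\<^sup>2"
      using B[of "Suc j"] j by (intro mult_right_mono) (auto simp: l_def)
    also have "\<dots> = c / 64 * (l * P1)\<^sup>2" by (simp add: power_mult_distrib)
    also have "\<dots> \<le> c / 64 * (4 * P2\<^sup>2)" using sq c by (intro mult_left_mono) auto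
    finally have t1: "\<bar>s (Suc j) * P1\<^sup>2\<bar> \<le> c * P2\<^sup>2 / 16" by simp
    have PP: "16 * \<bar>P1\<bar> \<le> 2 * \<bar>P2\<bar>"
      using mult_right_mono[of 16 l "\<bar>P1\<bar>"] l P12(2) by linarith
    have P2eq: "g (Suc j) * P1 = P2 + P0" by (simp add: P0_def P1_def P2_def)
    have "\<bar>g (Suc j) * jacobi2 g s (Suc j)\<bar> \<le> \<bar>g (Suc j)\<bar> * (c * P1\<^sup>2)"
      unfolding abs_mult using ih1 by (intro mult_left_mono) auto
    also have "\<dots> = c * (\<bar>g (Suc j) * P1\<bar> * \<bar>P1\<bar>)"
    proof -
      have "P1\<^sup>2 = \<bar>P1\<bar> * \<bar>P1\<bar>" by (simp add: power2_eq_square)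
      then show ?thesis by (simp only: abs_mult mult_ac)
    qed
    also have "\<dots> \<le> c * ((2 * \<bar>P2\<bar>) * (\<bar>P2\<bar> / 8))"
      using P2eq P01 P12(1) PP c by (intro mult_left_mono mult_mono) auto
    also have "\<dots> = c * P2\<^sup>2 / 4" by (simp add: power2_eq_square)
    finally have t2: "\<bar>g (Suc j) * jacobi2 g s (Suc j)\<bar> \<le> c * P2\<^sup>2 / 4" .
    have "P0\<^sup>2 \<le> (\<bar>P2\<bar> / 8)\<^sup>2"
      using P01 PP by (intro abs_le_square_iff[THEN iffD1]) auto
    then have "c * P0\<^sup>2 \<le> c * (P2\<^sup>2 / 64)"
      using c by (intro mult_left_mono) (simp_all add: power_divide)
    moreover have "0 \<le> c * P2\<^sup>2" using c by simp
    ultimately show ?thesis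
      using t1 t2 ih0 unfolding 3 jacobi2.simps P1_def[symmetric] P2_def[symmetric] by linarith
  qed (simp_all add: c)
qed

lemma orbit_lift_deriv:
  assumes diff: "\<And>k z. 1 \<le> k \<Longrightarrow> (f k has_real_derivative deriv (f k) z) (at z)"
  shows "((\<lambda>x. orbit_lift f x y n) has_real_derivative jacobi (slope f x y) n) (at x)"
proof (induction n rule: less_induct)
  case (less n)
  consider "n = 0" | "n = 1" | j where "n = Suc (Suc j)"
    by (metis One_nat_def not0_implies_Suc)
  then show ?case
  proof cases
    case 3
    note ih = less.IH[of "Suc j"] less.IH[of j]
    show ?thesis
      unfolding 3 orbit_lift.simps jacobi.simps
      by (intro DERIV_diff DERIV_chain2[OF diff]) (use ih 3 in auto)
  qed auto
qed

lemma jacobi_deriv: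
  assumes diff: "\<And>k z. 1 \<le> k \<Longrightarrow> (f k has_real_derivative deriv (f k) z) (at z)"
    and diff2: "\<And>k z. 1 \<le> k \<Longrightarrow> (deriv (f k) has_real_derivative deriv (deriv (f k)) z) (at z)"
  shows "((\<lambda>x. jacobi (slope f x y) n) has_real_derivative
           jacobi2 (slope f x y) (bend f x y) n) (at x)"
proof (induction n rule: less_induct)
  case (less n)
  consider "n = 0" | "n = 1" | j where "n = Suc (Suc j)"
    by (metis One_nat_def not0_implies_Suc)
  then show ?case
  proof cases
    case 3
    have ih: "((\<lambda>x. jacobi (slope f x y) (Suc j)) has_real_derivative
           jacobi2 (slope f x y) (bend f x y) (Suc j)) (at x)"
        "((\<lambda>x. jacobi (slope f x y) j) has_real_derivative
           jacobi2 (slope f x y) (bend f x y) j) (at x)"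
      using less.IH 3 by auto
    have sl: "((\<lambda>x. slope f x y (Suc j)) has_real_derivative
        bend f x y (Suc j) * jacobi (slope f x y) (Suc j)) (at x)"
      by (rule DERIV_chain2[OF diff2 orbit_lift_deriv[OF diff]]) auto
    show ?thesis
      unfolding 3 jacobi.simps jacobi2.simps
      using DERIV_diff[OF DERIV_mult[OF sl ih(1)] ih(2)]
      by (simp add: power2_eq_square algebra_simps)
  qed auto
qed

section \<open>Oscillatory integrals over horizontal circles\<close>

text \<open>A differentiable function that vanishes on \<open>[-1, 1]\<close> and is \<open>1\<close> outside \<open>(-2, 2)\<close>. As a
  composition of squared positive parts it needs no case distinctions.\<close>

definition bump :: "real \<Rightarrow> real" where
  "bump t = 1 - (max 0 (1 - (max 0 (t\<^sup>2 - 1))\<^sup>2))\<^sup>2"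

text \<open>The building block of the cutoff: squaring the positive part makes it differentiable at \<open>0\<close>.\<close>

lemma max_square_deriv: "((\<lambda>x::real. (max 0 x)\<^sup>2) has_real_derivative 2 * max 0 x) (at x)"
proof -
  consider "x < 0" | "x = 0" | "0 < x" by linarith
  then show ?thesis
  proof cases
    case 1
    have "((\<lambda>x::real. 0) has_real_derivative 2 * max 0 x) (at x)" using 1 by simp
    then show ?thesis
      by (rule has_field_derivative_transform_within_open[of _ _ _ "{..<0}"]) (use 1 in auto)
  next
    case 2
    have "((\<lambda>h::real. ((max 0 (0 + h))\<^sup>2 - (max 0 0)\<^sup>2) / h) \<longlongrightarrow> 0) (at 0)"
    proof (rule Lim_null_comparison[where g = "\<lambda>h. \<bar>h\<bar>"])
      show "\<forall>\<^sub>F h::real in at 0. norm (((max 0 (0 + h))\<^sup>2 - (max 0 0)\<^sup>2) / h) \<le> \<bar>h\<bar>"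
        by (rule always_eventually) (auto simp: max_def power2_eq_square)
    qed (auto intro!: tendsto_eq_intros)
    then show ?thesis unfolding 2 DERIV_def by simp
  next
    case 3
    have "((\<lambda>x::real. x\<^sup>2) has_real_derivative 2 * max 0 x) (at x)"
      using 3 by (auto intro!: derivative_eq_intros)
    then show ?thesis
      by (rule has_field_derivative_transform_within_open[of _ _ _ "{0<..}"]) (use 3 in auto)
  qed
qed

lemma bump_bounds: "0 \<le> bump t" "bump t \<le> 1"
proof -
  define m where "m = max 0 (1 - (max 0 (t\<^sup>2 - 1))\<^sup>2)"
  have "0 \<le> m" "m \<le> 1" by (auto simp: m_def)
  then have "m\<^sup>2 \<le> 1" by (simp add: power_le_one)
  then show "0 \<le> bump t" "bump t \<le> 1" by (auto simp: bump_def m_def)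
qed

lemma bump_eq_0: "\<bar>t\<bar> \<le> 1 \<Longrightarrow> bump t = 0"
  using abs_square_le_1[of t] by (simp add: bump_def)

lemma bump_eq_1: "2 \<le> \<bar>t\<bar> \<Longrightarrow> bump t = 1"
proof -
  assume "2 \<le> \<bar>t\<bar>"
  then have "2\<^sup>2 \<le> \<bar>t\<bar>\<^sup>2" by (intro power_mono) auto
  then have "1 \<le> max 0 (t\<^sup>2 - 1)" by simp
  then have "1 \<le> (max 0 (t\<^sup>2 - 1))\<^sup>2" by (rule one_le_power)
  then show ?thesis by (simp add: bump_def)
qed

lemma bump_deriv: "\<exists>d. (bump has_real_derivative d) (at t) \<and> \<bar>d\<bar> \<le> 16"
proof -
  define v u where "v = max 0 (t\<^sup>2 - 1)" and "u = v\<^sup>2"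
  have "((\<lambda>t. t\<^sup>2 - 1) has_real_derivative 2 * t) (at t)"
    by (auto intro!: derivative_eq_intros)
  from DERIV_diff[OF DERIV_const[of 1] DERIV_chain2[OF max_square_deriv this]]
  have "((\<lambda>t. 1 - (max 0 (t\<^sup>2 - 1))\<^sup>2) has_real_derivative - (2 * v * (2 * t))) (at t)"
    by (simp add: v_def)
  from DERIV_diff[OF DERIV_const[of 1] DERIV_chain2[OF max_square_deriv this]]
  have "(bump has_real_derivative 2 * max 0 (1 - u) * (2 * v * (2 * t))) (at t)"
    by (simp add: bump_def[abs_def] u_def v_def)
  moreover have "\<bar>2 * max 0 (1 - u) * (2 * v * (2 * t))\<bar> \<le> 16"
  proof (cases "u \<ge> 1")
    case False
    have v: "0 \<le> v" "v \<le> 1"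
    proof -
      show "0 \<le> v" by (simp add: v_def)
      then show "v \<le> 1" using False abs_square_less_1[of v] by (simp add: u_def)
    qed
    have "t\<^sup>2 - 1 \<le> v" by (simp add: v_def)
    then have "t\<^sup>2 \<le> 2\<^sup>2" using v(2) by simp
    then have t: "\<bar>t\<bar> \<le> 2" using abs_le_square_iff[of t 2] by simp
    have u: "0 \<le> u" by (simp add: u_def)
    have "\<bar>2 * max 0 (1 - u) * (2 * v * (2 * t))\<bar> = (2 * max 0 (1 - u)) * (2 * v * (2 * \<bar>t\<bar>))"
      using v by (simp add: abs_mult)
    also have "\<dots> \<le> (2 * 1) * (2 * 1 * (2 * 2))"
      using v t u by (intro mult_mono) auto
    finally show ?thesis by simp
  qed simp
  ultimately show ?thesis by blast
qed

lemma continuous_bump: "continuous_on UNIV bump"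
  using bump_deriv by (meson DERIV_isCont continuous_at_imp_continuous_on)

definition cutoff :: "(nat \<Rightarrow> real \<Rightarrow> real) \<Rightarrow> (nat \<Rightarrow> real) \<Rightarrow> nat \<Rightarrow> real \<Rightarrow> real \<Rightarrow> real" where
  "cutoff f lam n x y = (\<Prod>k=1..n. bump (slope f x y k / lam k))"

lemma cutoff_Suc:
  "cutoff f lam (Suc n) x y = cutoff f lam n x y * bump (slope f x y (Suc n) / lam (Suc n))"
  by (simp add: cutoff_def)

lemma cutoff_bounds: "0 \<le> cutoff f lam n x y" "cutoff f lam n x y \<le> 1"
  by (auto simp: cutoff_def bump_bounds intro!: prod_nonneg prod_le_1)

text \<open>A union bound: an orbit is discarded only if it is discarded at some time.\<close>

lemma one_minus_cutoff_le:
  "1 - cutoff f lam n x y \<le> (\<Sum>k=1..n. 1 - bump (slope f x y k / lam k))"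
proof (induction n)
  case (Suc n)
  define b where "b = bump (slope f x y (Suc n) / lam (Suc n))"
  have b: "0 \<le> b" "b \<le> 1" by (simp_all add: b_def bump_bounds)
  have "0 \<le> (1 - cutoff f lam n x y) * (1 - b)"
    using b cutoff_bounds[of f lam n x y] by (intro mult_nonneg_nonneg) auto
  then have "1 - cutoff f lam n x y * b \<le> (1 - cutoff f lam n x y) + (1 - b)"
    by (simp add: algebra_simps)
  with Suc show ?case
    unfolding cutoff_Suc b_def[symmetric] by (simp add: b_def)
qed (simp add: cutoff_def)

text \<open>Maps with bounded second derivatives, together with slope thresholds \<open>lam k\<close> so large that \<open>c\<close> controls
  both the relative curvature \<open>B k / (lam k)\<^sup>2\<close> and the inverse slopes. The constants \<open>16\<close> and \<open>64\<close>
  leave room for the estimates of one step to reproduce themselves in the next.\<close>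

locale steep_maps =
  fixes f :: "nat \<Rightarrow> real \<Rightarrow> real" and lam B :: "nat \<Rightarrow> real" and c :: real
  assumes diff: "\<And>k z. 1 \<le> k \<Longrightarrow> (f k has_real_derivative deriv (f k) z) (at z)"
    and diff2: "\<And>k z. 1 \<le> k \<Longrightarrow> (deriv (f k) has_real_derivative deriv (deriv (f k)) z) (at z)"
    and bend_le: "\<And>k z. 1 \<le> k \<Longrightarrow> \<bar>deriv (deriv (f k)) z\<bar> \<le> B k"
    and lam_ge: "\<And>k. 1 \<le> k \<Longrightarrow> 16 \<le> lam k"
    and B_le: "\<And>k. 1 \<le> k \<Longrightarrow> 64 * B k \<le> c * (lam k)\<^sup>2"
    and c_lam: "\<And>k. 1 \<le> k \<Longrightarrow> 1 \<le> c * lam k"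
begin

definition good :: "nat \<Rightarrow> real \<Rightarrow> real \<Rightarrow> bool" where
  "good n x y \<longleftrightarrow> (\<forall>k. 1 \<le> k \<longrightarrow> k \<le> n \<longrightarrow> lam k \<le> \<bar>slope f x y k\<bar>)"

lemma c_nonneg: "0 \<le> c"
proof (rule ccontr)
  assume "\<not> 0 \<le> c"
  then have "c * lam 1 \<le> 0" using lam_ge[of 1] by (intro mult_nonpos_nonneg) auto
  then show False using c_lam[of 1] by simp
qed

lemma goodD: "good n x y \<Longrightarrow> 1 \<le> k \<Longrightarrow> k \<le> n \<Longrightarrow> 16 \<le> lam k \<and> lam k \<le> \<bar>slope f x y k\<bar>"
  by (simp add: good_def lam_ge)

lemma good_growth:
  assumes "good n x y" "k \<le> n"
  shows "\<bar>jacobi (slope f x y) k\<bar> \<le> \<bar>jacobi (slope f x y) (Suc k)\<bar>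
    \<and> 1 \<le> \<bar>jacobi (slope f x y) (Suc k)\<bar>
    \<and> (1 \<le> k \<longrightarrow> lam k * \<bar>jacobi (slope f x y) k\<bar> \<le> 2 * \<bar>jacobi (slope f x y) (Suc k)\<bar>)"
  by (rule jacobi_growth[OF goodD[OF assms(1)] assms(2)])

lemma slope_deriv:
  assumes "1 \<le> k"
  shows "((\<lambda>x. slope f x y k) has_real_derivative bend f x y k * jacobi (slope f x y) k) (at x)"
  using assms by (intro DERIV_chain2[OF diff2 orbit_lift_deriv] diff)

text \<open>Differentiating the \<open>k\<close>-th factor of the cutoff produces \<open>f\<^sub>k''/lam k\<close> times the derivative at time \<open>k\<close>,
  which is small compared with the derivative at time \<open>k + 1\<close>. The contributions of earlier factors
  shrink further in each step, so the sum over all factors is controlled by the last one.\<close>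

lemma cutoff_deriv:
  assumes "good n x y"
  shows "m \<le> n \<Longrightarrow> \<exists>D. ((\<lambda>x. cutoff f lam m x y) has_real_derivative D) (at x)
    \<and> \<bar>D\<bar> \<le> c * \<bar>jacobi (slope f x y) (Suc m)\<bar>"
proof (induction m)
  case 0
  then show ?case using c_nonneg by (intro exI[of _ 0]) (simp add: cutoff_def)
next
  case (Suc m)
  define P P' l where "P = \<bar>jacobi (slope f x y) (Suc m)\<bar>"
    and "P' = \<bar>jacobi (slope f x y) (Suc (Suc m))\<bar>" and "l = lam (Suc m)"
  have l: "16 \<le> l" by (simp add: l_def lam_ge)
  obtain D where D: "((\<lambda>x. cutoff f lam m x y) has_real_derivative D) (at x)" "\<bar>D\<bar> \<le> c * P"
    using Suc by (auto simp: P_def)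
  obtain d where d: "(bump has_real_derivative d) (at (slope f x y (Suc m) / l))" "\<bar>d\<bar> \<le> 16"
    using bump_deriv by blast
  have "((\<lambda>x. slope f x y (Suc m) / l) has_real_derivative
      bend f x y (Suc m) * jacobi (slope f x y) (Suc m) / l) (at x)"
    by (intro DERIV_cdivide slope_deriv) simp
  from DERIV_mult[OF D(1) DERIV_chain2[OF d(1) this]]
  have der: "((\<lambda>x. cutoff f lam (Suc m) x y) has_real_derivative
      D * bump (slope f x y (Suc m) / l)
      + d * (bend f x y (Suc m) * jacobi (slope f x y) (Suc m) / l) * cutoff f lam m x y) (at x)"
    unfolding cutoff_Suc l_def[symmetric] .
  have t1: "\<bar>D * bump (slope f x y (Suc m) / l)\<bar> \<le> c * P * 1"
    unfolding abs_mult using D(2) bump_bounds by (intro mult_mono) auto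
  have "\<bar>d * (bend f x y (Suc m) * jacobi (slope f x y) (Suc m) / l) * cutoff f lam m x y\<bar>
      = \<bar>d\<bar> * (\<bar>bend f x y (Suc m)\<bar> * P / l) * cutoff f lam m x y"
    using l cutoff_bounds by (simp add: abs_mult P_def)
  also have "\<dots> \<le> 16 * ((c * l\<^sup>2 / 64) * P / l) * 1"
  proof (intro mult_mono divide_right_mono)
    show "\<bar>bend f x y (Suc m)\<bar> \<le> c * l\<^sup>2 / 64"
      using bend_le[of "Suc m" "orbit_lift f x y (Suc m)"] B_le[of "Suc m"] by (simp add: l_def)
  qed (use d l c_nonneg cutoff_bounds in \<open>auto simp: P_def\<close>)
  also have "\<dots> = c / 4 * (l * P)" using l by (simp add: power2_eq_square)
  finally have t2: "\<bar>d * (bend f x y (Suc m) * jacobi (slope f x y) (Suc m) / l) * cutoff f lam m x y\<bar>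
      \<le> c / 4 * (l * P)" .
  have P': "l * P \<le> 2 * P'"
    using good_growth[OF assms, of "Suc m"] Suc.prems by (simp add: P_def P'_def l_def)
  have "16 * P \<le> l * P" using l by (intro mult_right_mono) (auto simp: P_def)
  then have "c * P * 1 \<le> c * (P' / 8)"
    unfolding mult_1_right using P' c_nonneg by (intro mult_left_mono) linarith+
  moreover have "c / 4 * (l * P) \<le> c / 4 * (2 * P')" using P' c_nonneg by (intro mult_left_mono) auto
  ultimately have "c * P * 1 + c / 4 * (l * P) \<le> c * (P' / 8) + c / 4 * (2 * P')"
    by (rule add_mono)
  also have "\<dots> \<le> c * P'"
    using c_nonneg by (simp add: P'_def)
  finally   have "\<bar>D * bump (slope f x y (Suc m) / l)
      + d * (bend f x y (Suc m) * jacobi (slope f x y) (Suc m) / l) * cutoff f lam m x y\<bar> \<le> c * P'"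
    by (rule order.trans[OF abs_triangle_ineq order.trans[OF add_mono[OF t1 t2]]])
  with der show ?case unfolding P'_def by blast
qed

text \<open>The cutoff vanishes in a neighbourhood of every bad point, so that \<open>cutoff / \<Phi>'\<close> is differentiable
  there although \<open>\<Phi>'\<close> may have zeros.\<close>

lemma cutoff_eventually_0:
  assumes "\<not> good n x y"
  shows "\<forall>\<^sub>F z in nhds x. cutoff f lam n z y = 0"
proof -
  obtain k where k: "1 \<le> k" "k \<le> n" "\<bar>slope f x y k\<bar> < lam k"
    using assms by (auto simp: good_def not_le)
  have "isCont (\<lambda>z. \<bar>slope f z y k\<bar>) x"
    using DERIV_isCont[OF slope_deriv[OF k(1)]] by (intro continuous_intros) auto
  then have "\<forall>\<^sub>F z in at x. \<bar>slope f z y k\<bar> < lam k"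
    unfolding isCont_def using k(3) by (rule order_tendstoD)
  then have "\<forall>\<^sub>F z in nhds x. \<bar>slope f z y k\<bar> < lam k"
    using k(3) by (simp add: eventually_nhds_conv_at)
  then show ?thesis
  proof eventually_elim
    case (elim z)
    then have "bump (slope f z y k / lam k) = 0"
      using lam_ge[OF k(1)] by (intro bump_eq_0) (simp add: field_simps)
    then show ?case using k unfolding cutoff_def by (intro prod_zero) auto
  qed
qed

lemma cutoff_not_good: "\<not> good n x y \<Longrightarrow> cutoff f lam n x y = 0"
  using cutoff_eventually_0 eventually_nhds_x_imp_x by fastforce

lemma cutoff_differentiable: "\<exists>D. ((\<lambda>x. cutoff f lam n x y) has_real_derivative D) (at x)"
proof (cases "good n x y")
  case True
  then show ?thesis using cutoff_deriv[of n x y n] by blast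
next
  case False
  have "((\<lambda>x. cutoff f lam n x y) has_real_derivative 0) (at x)
      \<longleftrightarrow> ((\<lambda>x. 0) has_real_derivative 0) (at x)"
    by (rule DERIV_cong_ev[OF refl cutoff_eventually_0[OF False] refl])
  then show ?thesis by auto
qed

text \<open>The last derivative dominates the phase: the other two terms are smaller by the factor \<open>lam n\<close>, which
  beats the frequencies.\<close>

lemma phase_slope:
  assumes g: "good n x y" and n: "1 \<le> n"
    and A: "1 \<le> \<bar>a\<bar>" "\<bar>b\<bar> \<le> A" "\<bar>a'\<bar> \<le> A" "16 * A \<le> lam n"
  shows "\<bar>jacobi (slope f x y) (Suc n)\<bar> * 3 / 4
    \<le> \<bar>a * jacobi (slope f x y) (Suc n) + b * jacobi (slope f x y) n + a'\<bar>"
proof -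
  define P P' l where "P = jacobi (slope f x y) n" and "P' = jacobi (slope f x y) (Suc n)"
    and "l = lam n"
  obtain m where m: "n = Suc m" using n by (cases n) auto
  have P1: "1 \<le> \<bar>P\<bar>"
    using good_growth[OF g, of m] by (simp add: m P_def)
  have P': "l * \<bar>P\<bar> \<le> 2 * \<bar>P'\<bar>"
    using good_growth[OF g, of n] n by (simp add: P_def P'_def l_def)
  have "16 * A * \<bar>P\<bar> \<le> l * \<bar>P\<bar>" using A by (intro mult_right_mono) (auto simp: l_def)
  then have AP: "A * \<bar>P\<bar> \<le> \<bar>P'\<bar> / 8" using P' by simp
  have "\<bar>b * P\<bar> \<le> A * \<bar>P\<bar>" unfolding abs_mult using A by (intro mult_right_mono) auto
  moreover have "A * 1 \<le> A * \<bar>P\<bar>" using A P1 by (intro mult_left_mono) auto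
  moreover have "1 * \<bar>P'\<bar> \<le> \<bar>a * P'\<bar>" unfolding abs_mult using A by (intro mult_right_mono) auto
  ultimately show ?thesis
    unfolding P_def[symmetric] P'_def[symmetric] using AP A by linarith
qed

text \<open>Integration by parts with \<open>W = cutoff / \<Phi>'\<close>: the boundary terms and \<open>W'\<close> are of order \<open>c\<close>, because \<open>W\<close>
  is of order \<open>1 / P\<close>, the derivative of the cutoff of order \<open>c P\<close> and \<open>\<Phi>''\<close> of order \<open>c P\<^sup>2\<close>, where
  \<open>P\<close> is the derivative of the last lifted coordinate.\<close>

lemma oscillation:
  fixes a b a' b' \<theta> A y :: real
  assumes n: "1 \<le> n"
    and A: "1 \<le> \<bar>a\<bar>" "\<bar>a\<bar> \<le> A" "\<bar>b\<bar> \<le> A" "\<bar>a'\<bar> \<le> A" "16 * A \<le> lam n"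
  defines "\<Phi> \<equiv> \<lambda>x. 2 * pi * (a * orbit_lift f x y (Suc n) + b * orbit_lift f x y n + a' * x + b' * y) + \<theta>"
  shows "\<bar>integral {0..1} (\<lambda>x. cutoff f lam n x y * cos (\<Phi> x))\<bar> \<le> c * (3 + 2 * A)"
proof -
  define \<Phi>1 where "\<Phi>1 = (\<lambda>x. 2 * pi * (a * jacobi (slope f x y) (Suc n) + b * jacobi (slope f x y) n + a'))"
  define \<Phi>2 where "\<Phi>2 = (\<lambda>x. 2 * pi * (a * jacobi2 (slope f x y) (bend f x y) (Suc n)
    + b * jacobi2 (slope f x y) (bend f x y) n))"
  have d1: "(\<Phi> has_real_derivative \<Phi>1 x) (at x)" for x
    unfolding \<Phi>_def \<Phi>1_def
    by (rule derivative_eq_intros orbit_lift_deriv[OF diff] refl | simp)+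
  have d2: "(\<Phi>1 has_real_derivative \<Phi>2 x) (at x)" for x
    unfolding \<Phi>1_def \<Phi>2_def
    by (rule derivative_eq_intros jacobi_deriv[OF diff diff2] refl | simp)+
  define W where "W = (\<lambda>x. cutoff f lam n x y / \<Phi>1 x)"
  have key: "\<bar>W x\<bar> \<le> c \<and> (\<exists>w. (W has_real_derivative w) (at x) \<and> \<bar>w\<bar> \<le> c * (1 + 2 * A))
      \<and> W x * \<Phi>1 x = cutoff f lam n x y" for x
  proof (cases "good n x y")
    case False
    have "\<forall>\<^sub>F z in nhds x. W z = 0"
      using cutoff_eventually_0[OF False] by eventually_elim (simp add: W_def)
    then have "(W has_real_derivative 0) (at x) \<longleftrightarrow> ((\<lambda>x. 0) has_real_derivative 0) (at x)"
      by (intro DERIV_cong_ev) auto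
    then show ?thesis
      using cutoff_not_good[OF False] c_nonneg A by (auto simp: W_def intro!: exI[of _ 0])
  next
    case True
    define P where "P = \<bar>jacobi (slope f x y) (Suc n)\<bar>"
    obtain m where m: "n = Suc m" using n by (cases n) auto
    have Pn: "\<bar>jacobi (slope f x y) n\<bar> \<le> P" "1 \<le> P" "lam n * \<bar>jacobi (slope f x y) n\<bar> \<le> 2 * P"
      using good_growth[OF True, of n] n by (auto simp: P_def)
    have P1: "1 \<le> \<bar>jacobi (slope f x y) n\<bar>"
      using good_growth[OF True, of m] by (simp add: m)
    have "lam n * 1 \<le> lam n * \<bar>jacobi (slope f x y) n\<bar>"
      using P1 lam_ge[OF n] by (intro mult_left_mono) auto
    then have "lam n \<le> 2 * P" using Pn by linarith
    then have "c * lam n \<le> c * (2 * P)" using c_nonneg by (intro mult_left_mono) auto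
    then have cP: "1 \<le> 2 * c * P" using c_lam[OF n] by linarith
    have ph: "P * 3 / 4 \<le> \<bar>a * jacobi (slope f x y) (Suc n) + b * jacobi (slope f x y) n + a'\<bar>"
      unfolding P_def by (rule phase_slope[OF True n A(1,3,4,5)])
    \<comment> \<open>\<open>pi > 3\<close> is enough: \<open>2 * 3 * 3/4\<close> exceeds \<open>4\<close>.\<close>
    have "4 * P \<le> 2 * 3 * (P * 3 / 4)" using Pn(2) by simp
    also have "\<dots> \<le> 2 * pi * \<bar>a * jacobi (slope f x y) (Suc n) + b * jacobi (slope f x y) n + a'\<bar>"
      using ph pi_gt3 Pn(2) by (intro mult_mono) auto
    also have "\<dots> = \<bar>\<Phi>1 x\<bar>" by (simp add: \<Phi>1_def abs_mult)
    finally have low: "4 * P \<le> \<bar>\<Phi>1 x\<bar>" .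
    then have nz: "\<Phi>1 x \<noteq> 0" using Pn(2) by auto
    obtain D where D: "((\<lambda>x. cutoff f lam n x y) has_real_derivative D) (at x)" "\<bar>D\<bar> \<le> c * P"
      using cutoff_deriv[OF True, of n] by (auto simp: P_def)
    have dW: "(W has_real_derivative
        D / \<Phi>1 x - cutoff f lam n x y * \<Phi>2 x / (\<Phi>1 x)\<^sup>2) (at x)"
      unfolding W_def using DERIV_divide[OF D(1) d2 nz] nz
      by (simp add: field_simps power2_eq_square)
    have "\<bar>D / \<Phi>1 x\<bar> \<le> c * P / (4 * P)"
      unfolding abs_divide using D(2) low Pn(2) c_nonneg by (intro frac_le) auto
    then have t1: "\<bar>D / \<Phi>1 x\<bar> \<le> c / 4" using Pn(2) by simp
    have q: "\<bar>jacobi2 (slope f x y) (bend f x y) (Suc n)\<bar> \<le> c * P\<^sup>2"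
        "\<bar>jacobi2 (slope f x y) (bend f x y) n\<bar> \<le> c * P\<^sup>2"
    proof -
      have bd: "\<bar>jacobi2 (slope f x y) (bend f x y) k\<bar> \<le> c * (jacobi (slope f x y) k)\<^sup>2"
        if "k \<le> Suc n" for k
        using that by (intro jacobi2_bound[OF goodD[OF True] bend_le B_le c_nonneg]) auto
      show "\<bar>jacobi2 (slope f x y) (bend f x y) (Suc n)\<bar> \<le> c * P\<^sup>2"
        using bd[of "Suc n"] by (simp add: P_def)
      have "(jacobi (slope f x y) n)\<^sup>2 \<le> P\<^sup>2"
        using Pn(1) by (simp add: abs_le_square_iff[symmetric] P_def)
      then have "c * (jacobi (slope f x y) n)\<^sup>2 \<le> c * P\<^sup>2"
        using c_nonneg by (rule mult_left_mono)
      then show "\<bar>jacobi2 (slope f x y) (bend f x y) n\<bar> \<le> c * P\<^sup>2"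
        using bd[of n] by linarith
    qed
    have "\<bar>\<Phi>2 x\<bar> \<le> 2 * pi * (\<bar>a\<bar> * (c * P\<^sup>2) + \<bar>b\<bar> * (c * P\<^sup>2))"
      unfolding \<Phi>2_def abs_mult
      by (intro mult_mono order.trans[OF abs_triangle_ineq] add_mono)
         (use q in \<open>auto simp: abs_mult intro!: mult_left_mono\<close>)
    also have "\<dots> \<le> 2 * 4 * (A * (c * P\<^sup>2) + A * (c * P\<^sup>2))"
      using A c_nonneg pi_less_4 by (intro mult_mono add_mono) auto
    finally have P2: "\<bar>\<Phi>2 x\<bar> \<le> 16 * A * c * P\<^sup>2" by (simp add: mult_ac)
    have "\<bar>cutoff f lam n x y * \<Phi>2 x / (\<Phi>1 x)\<^sup>2\<bar> = cutoff f lam n x y * \<bar>\<Phi>2 x\<bar> / \<bar>\<Phi>1 x\<bar>\<^sup>2"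
      using cutoff_bounds by (simp add: abs_mult)
    also have "\<dots> \<le> 1 * (16 * A * c * P\<^sup>2) / (4 * P)\<^sup>2"
      using P2 low Pn(2) cutoff_bounds[of f lam n x y] A c_nonneg
      by (intro frac_le mult_mono power_mono) auto
    also have "\<dots> = A * c" using Pn(2) by (simp add: power_mult_distrib)
    finally have t2: "\<bar>cutoff f lam n x y * \<Phi>2 x / (\<Phi>1 x)\<^sup>2\<bar> \<le> A * c" .
    have "\<bar>W x\<bar> \<le> 1 / (4 * P)"
      unfolding W_def abs_divide using low Pn(2) cutoff_bounds[of f lam n x y]
      by (intro frac_le) auto
    also have "\<dots> \<le> c / 2" using cP Pn(2) by (simp add: field_simps)
    finally have W: "\<bar>W x\<bar> \<le> c" using c_nonneg by linarith
    have "0 \<le> A * c" using A c_nonneg by simp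
    then have "c / 4 + A * c \<le> c * (1 + 2 * A)"
      using c_nonneg by (simp add: algebra_simps)
    then have "\<bar>D / \<Phi>1 x - cutoff f lam n x y * \<Phi>2 x / (\<Phi>1 x)\<^sup>2\<bar> \<le> c * (1 + 2 * A)"
      by (rule order.trans[OF abs_triangle_ineq4 order.trans[OF add_mono[OF t1 t2]]])
    with W dW nz show ?thesis by (auto simp: W_def)
  qed
  then have "\<forall>x. \<exists>w. (W has_real_derivative w) (at x) \<and> \<bar>w\<bar> \<le> c * (1 + 2 * A)"
    by blast
  then obtain w where w: "\<And>x. (W has_real_derivative w x) (at x)" "\<And>x. \<bar>w x\<bar> \<le> c * (1 + 2 * A)"
    by metis
  have "((\<lambda>x. w x * sin (\<Phi> x) + cutoff f lam n x y * cos (\<Phi> x))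
      has_integral W 1 * sin (\<Phi> 1) - W 0 * sin (\<Phi> 0)) {0..1}"
  proof (rule fundamental_theorem_of_calculus)
    fix x :: real
    have "((\<lambda>x. sin (\<Phi> x)) has_real_derivative cos (\<Phi> x) * \<Phi>1 x) (at x)"
      by (rule DERIV_chain2[OF DERIV_sin d1])
    from DERIV_mult[OF w(1) this]
    have "((\<lambda>x. W x * sin (\<Phi> x)) has_real_derivative
        w x * sin (\<Phi> x) + (W x * \<Phi>1 x) * cos (\<Phi> x)) (at x)"
      by (simp add: mult_ac)
    then show "((\<lambda>x. W x * sin (\<Phi> x)) has_vector_derivative
        w x * sin (\<Phi> x) + cutoff f lam n x y * cos (\<Phi> x)) (at x within {0..1})"
      using key[of x]
      by (simp add: has_field_derivative_at_within flip: has_real_derivative_iff_has_vector_derivative)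
  qed simp
  moreover have "(\<lambda>x. cutoff f lam n x y * cos (\<Phi> x)) integrable_on {0..1}"
  proof (intro integrable_continuous_real continuous_at_imp_continuous_on ballI continuous_mult)
    fix x show "isCont (\<lambda>x. cutoff f lam n x y) x"
      using cutoff_differentiable DERIV_isCont by blast
    show "isCont (\<lambda>x. cos (\<Phi> x)) x"
      using DERIV_isCont[OF d1] by (intro continuous_intros)
  qed
  from has_integral_diff[OF calculation integrable_integral[OF this]]
  have "((\<lambda>x. w x * sin (\<Phi> x)) has_integral
      (W 1 * sin (\<Phi> 1) - W 0 * sin (\<Phi> 0))
      - integral {0..1} (\<lambda>x. cutoff f lam n x y * cos (\<Phi> x))) {0..1}"
    by simp
  then have "norm ((W 1 * sin (\<Phi> 1) - W 0 * sin (\<Phi> 0))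
      - integral {0..1} (\<lambda>x. cutoff f lam n x y * cos (\<Phi> x))) \<le> c * (1 + 2 * A) * measure lborel {0..1::real}"
  proof (rule has_integral_bound_real[rotated 2])
    have "\<bar>w x * sin (\<Phi> x)\<bar> \<le> c * (1 + 2 * A) * 1" for x
      unfolding abs_mult using w(2) c_nonneg A by (intro mult_mono) auto
    then show "norm (w x * sin (\<Phi> x)) \<le> c * (1 + 2 * A)" for x
      by simp
  qed (use c_nonneg A in auto)
  then have "\<bar>(W 1 * sin (\<Phi> 1) - W 0 * sin (\<Phi> 0))
      - integral {0..1} (\<lambda>x. cutoff f lam n x y * cos (\<Phi> x))\<bar> \<le> c * (1 + 2 * A)"
    by simp
  moreover have Wsin: "\<bar>W x * sin (\<Phi> x)\<bar> \<le> c * 1" for x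
    unfolding abs_mult using key[of x] c_nonneg by (intro mult_mono) auto
  have "\<bar>W 1 * sin (\<Phi> 1) - W 0 * sin (\<Phi> 0)\<bar> \<le> 2 * c"
    using Wsin[of 0] Wsin[of 1] by linarith
  ultimately show ?thesis by (simp add: algebra_simps)
qed

end

section \<open>Neighbourhoods of critical points\<close>

lemma periodic1_int:
  assumes "periodic1 g"
  shows "g (x + of_int k) = g x"
proof (induction k rule: int_induct[where k = 0])
  case (step1 i)
  then show ?case using assms[unfolded periodic1_def, rule_format, of "x + of_int i"] by (simp add: add_ac)
next
  case (step2 i)
  then show ?case using assms[unfolded periodic1_def, rule_format, of "x + of_int i - 1"]
    by (simp add: algebra_simps)
qed simp

lemma periodic1_deriv:
  assumes "periodic1 g" and d: "\<And>z. (g has_real_derivative deriv g z) (at z)"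
  shows "periodic1 (deriv g)"
  unfolding periodic1_def
proof
  fix x
  have "((\<lambda>x. g (x + 1)) has_real_derivative deriv g (x + 1)) (at x)"
    using d[of "x + 1"] DERIV_shift by blast
  then have "(g has_real_derivative deriv g (x + 1)) (at x)"
    using assms(1) by (simp add: periodic1_def)
  then show "deriv g (x + 1) = deriv g x" using d[of x] DERIV_unique by blast
qed

lemma abs_le_C0_norm:
  assumes "periodic1 g" and "continuous_on UNIV g"
  shows "\<bar>g x\<bar> \<le> C0_norm g"
proof -
  have "bounded (g ` {0..1})"
    using assms(2) by (intro compact_imp_bounded compact_continuous_image)
      (auto intro: continuous_on_subset)
  then obtain b where "\<forall>y\<in>g ` {0..1}. norm y \<le> b"
    unfolding bounded_iff by blast
  then have b: "\<bar>g x\<bar> \<le> b" if "0 \<le> x" "x \<le> 1" for x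
    using that by simp
  have "\<bar>g (frac x)\<bar> \<le> C0_norm g"
    unfolding C0_norm_def
    by (rule cSUP_upper) (use b in \<open>auto simp: T1_def frac_lt_1 intro!: bdd_aboveI2[where M = b]\<close>)
  moreover have "g (frac x) = g x"
    using periodic1_int[OF assms(1), of "frac x" "\<lfloor>x\<rfloor>"] by (simp add: frac_def)
  ultimately show ?thesis by simp
qed

lemma C_diff_3D:
  assumes "C_diff 3 g"
  shows "(g has_real_derivative deriv g z) (at z)"
    and "(deriv g has_real_derivative deriv (deriv g) z) (at z)"
    and "(deriv (deriv g) has_real_derivative deriv (deriv (deriv g)) z) (at z)"
proof -
  have "(deriv ^^ j) g differentiable (at z)" if "j < 3" for j
    using assms that by (simp add: C_diff_def)
  from this[of 0] this[of 1] this[of 2]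
  show "(g has_real_derivative deriv g z) (at z)"
    and "(deriv g has_real_derivative deriv (deriv g) z) (at z)"
    and "(deriv (deriv g) has_real_derivative deriv (deriv (deriv g)) z) (at z)"
    by (simp_all add: DERIV_deriv_iff_real_differentiable eval_nat_numeral)
qed

context
  fixes K0 K1 l :: real and M0 :: nat and g :: "real \<Rightarrow> real"
  assumes adm: "admissible K0 K1 M0 l g"
begin

lemma admissible_periodic: "periodic1 g"
  using adm by (simp add: admissible_def)

lemma admissible_DERIV:
  "(g has_real_derivative deriv g z) (at z)"
  "(deriv g has_real_derivative deriv (deriv g) z) (at z)"
  "(deriv (deriv g) has_real_derivative deriv (deriv (deriv g)) z) (at z)"
  using C_diff_3D adm by (auto simp: admissible_def)

lemma admissible_continuous:
  "continuous_on UNIV g" "continuous_on UNIV (deriv g)" "continuous_on UNIV (deriv (deriv g))"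
  using admissible_DERIV by (meson DERIV_isCont continuous_at_imp_continuous_on)+

lemma admissible_periodic_deriv: "periodic1 (deriv g)"
  by (intro periodic1_deriv admissible_periodic admissible_DERIV)

lemma admissible_deriv2_le: "\<bar>deriv (deriv g) x\<bar> \<le> K0 * l"
proof -
  have "0 \<le> C0_norm (deriv g)"
    using abs_le_C0_norm[OF admissible_periodic_deriv admissible_continuous(2), of 0] by linarith
  moreover have "\<bar>deriv (deriv g) x\<bar> \<le> C0_norm (deriv (deriv g))"
    by (intro abs_le_C0_norm periodic1_deriv admissible_periodic_deriv admissible_DERIV
        admissible_continuous)
  moreover have "C0_norm (deriv g) + C0_norm (deriv (deriv g)) \<le> K0 * l"
    using adm by (simp add: admissible_def)
  ultimately show ?thesis by linarith
qed

text \<open>Rolle's theorem on one period. Without a critical point the distance to the critical set would be the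
  infimum of the empty set.\<close>

lemma admissible_crit_nonempty: "crit_set g \<noteq> {}"
proof -
  have "g 0 = g 1"
    using admissible_periodic by (simp add: periodic1_def) (metis add_0)
  then have "\<exists>z. 0 < z \<and> z < 1 \<and> deriv g z = 0"
  proof -
    have "\<exists>z>0. z < 1 \<and> (g has_real_derivative 0) (at z)"
      by (rule Rolle)
         (use \<open>g 0 = g 1\<close> admissible_continuous(1) admissible_DERIV(1) in
           \<open>auto intro: continuous_on_subset simp: real_differentiable_def\<close>)
    then show ?thesis using DERIV_imp_deriv by blast
  qed
  then show ?thesis by (force simp: crit_set_def T1_def)
qed

text \<open>Of the lifts of a critical point \<open>z\<close> in \<open>[0,1)\<close>, only \<open>z - 1\<close>, \<open>z\<close> and \<open>z + 1\<close> come closer than \<open>1\<close> to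
  \<open>[0,1)\<close>.\<close>

lemma admissible_near_critical:
  assumes "0 < l" "0 < K1" "r \<le> 1" and x: "x \<in> T1" and small: "\<bar>deriv g x\<bar> < l * inverse K1 * r"
  shows "x \<in> (\<Union>z\<in>crit_set g. \<Union>k\<in>{-1, 0, 1}. {z + k - r..z + k + r})"
proof -
  have fin: "finite (crit_set g)" using adm by (simp add: admissible_def)
  have "l * inverse K1 * setdist_T1 x (crit_set g) \<le> \<bar>deriv g x\<bar>"
    using adm x by (simp add: admissible_def)
  with small have "(l * inverse K1) * setdist_T1 x (crit_set g) < (l * inverse K1) * r" by linarith
  then have "setdist_T1 x (crit_set g) < r"
    using assms(1,2) by (simp add: mult_less_cancel_left)
  then obtain z where z: "z \<in> crit_set g" "dist_T1 x z < r"
    unfolding setdist_T1_def using admissible_crit_nonempty fin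
    by (subst (asm) cINF_less_iff) auto
  then obtain k :: int where k: "dist x (z + of_int k) < r"
    unfolding dist_T1_def by (subst (asm) infdist_notempty) (auto simp: cINF_less_iff bdd_below_image_dist)
  then have xk: "\<bar>x - (z + of_int k)\<bar> < r" by (simp add: dist_real_def)
  have "0 \<le> x" "x < 1" "0 \<le> z" "z < 1"
    using x z by (auto simp: crit_set_def T1_def)
  then have "- 2 < (of_int k :: real)" "(of_int k :: real) < 2"
    using xk assms(3) by linarith+
  then have "k \<in> {-1, 0, 1}" by auto
  then have "(of_int k :: real) \<in> {-1, 0, 1}" by auto
  moreover have "x \<in> {z + of_int k - r..z + of_int k + r}" using xk by auto
  ultimately show ?thesis using z(1) by blast
qed

lemma measure_near_critical:
  assumes "0 < l" "0 < K1" "0 \<le> r" "r \<le> 1"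
  shows "measure lborel {x \<in> T1. \<bar>deriv g x\<bar> < l * inverse K1 * r} \<le> 6 * real M0 * r"
proof -
  have fin: "finite (crit_set g)" and card: "card (crit_set g) \<le> M0"
    using adm by (auto simp: admissible_def)
  let ?I = "crit_set g \<times> {-1, 0, 1::real}"
  have "{x \<in> T1. \<bar>deriv g x\<bar> < l * inverse K1 * r} \<subseteq> (\<Union>(z, k)\<in>?I. {z + k - r..z + k + r})"
    using admissible_near_critical[OF assms(1,2,4)] by blast
  then have "measure lborel {x \<in> T1. \<bar>deriv g x\<bar> < l * inverse K1 * r}
      \<le> measure lborel (\<Union>(z, k)\<in>?I. {z + k - r..z + k + r})"
  proof (rule measure_mono_fmeasurable)
    have [measurable]: "deriv g \<in> borel_measurable borel"
      by (rule borel_measurable_continuous_onI[OF admissible_continuous(2)])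
    show "{x \<in> T1. \<bar>deriv g x\<bar> < l * inverse K1 * r} \<in> sets lborel"
      by measurable
    show "(\<Union>(z, k)\<in>?I. {z + k - r..z + k + r}) \<in> fmeasurable lborel"
      using fin by (intro fmeasurable.finite_UN) (auto simp: fmeasurable_def emeasure_lborel_Icc_eq)
  qed
  also have "\<dots> \<le> (\<Sum>(z, k)\<in>?I. measure lborel {z + k - r..z + k + r})"
    using measure_UNION_le[of ?I "\<lambda>(z, k). {z + k - r..z + k + r}" lborel] fin
    by (auto simp: case_prod_unfold)
  also have "\<dots> = real (card ?I) * (2 * r)"
    using assms(3) by (simp add: case_prod_unfold)
  also have "\<dots> = 6 * real (card (crit_set g)) * r"
    by (simp add: card_cartesian_product)
  also have "\<dots> \<le> 6 * real M0 * r"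
    using card assms(3) by (intro mult_right_mono) auto
  finally show ?thesis .
qed

end

section \<open>Decay of correlations of characters\<close>

lemma integrable_Leb_T2:
  fixes h :: "real \<times> real \<Rightarrow> real"
  assumes "h \<in> borel_measurable Leb_T2" and "\<And>p. p \<in> T2 \<Longrightarrow> \<bar>h p\<bar> \<le> b"
  shows "integrable Leb_T2 h"
  by (rule finite_measure.integrable_const_bound[OF finite_measure_Leb_T2 _ assms(1), of b])
     (use assms(2) in \<open>auto intro!: AE_I2\<close>)

text \<open>Fubini's theorem in the form used here: a bound on the Henstock--Kurzweil integrals over all horizontal
  slices, as the fundamental theorem of calculus provides it, bounds the Lebesgue integral over the torus.\<close>

lemma integral_Leb_T2_slices:
  fixes h :: "real \<times> real \<Rightarrow> real"
  assumes cont: "continuous_on UNIV h" and b: "\<And>p. \<bar>h p\<bar> \<le> b"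
    and slice: "\<And>y. \<bar>integral {0..1} (\<lambda>x. h (x, y))\<bar> \<le> B"
  shows "\<bar>\<integral>p. h p \<partial>Leb_T2\<bar> \<le> B"
proof -
  have hm: "h \<in> borel_measurable borel"
    by (rule borel_measurable_continuous_onI[OF cont])
  have int: "integrable (lborel \<Otimes>\<^sub>M lborel) (\<lambda>p. indicator T2 p *\<^sub>R h p)"
    using integrable_Leb_T2[OF measurable_Leb_T2[OF hm] b]
    unfolding Leb_T2_def lborel_prod by (subst (asm) integrable_restrict_space) auto
  have slice_eq: "(\<integral>x. indicator T2 (x, y) *\<^sub>R h (x, y) \<partial>lborel)
      = indicator T1 y * integral {0..1} (\<lambda>x. h (x, y))" for y
  proof -
    have cy: "continuous_on {0..1} (\<lambda>x. h (x, y))"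
      by (intro continuous_on_compose2[OF cont] continuous_intros) auto
    have "(\<integral>x. indicator T2 (x, y) *\<^sub>R h (x, y) \<partial>lborel)
        = indicator T1 y * (\<integral>x. indicator T1 x * h (x, y) \<partial>lborel)"
      by (subst integral_mult_right_zero[symmetric])
         (auto intro!: Bochner_Integration.integral_cong simp: T2_def indicator_def)
    also have "(\<integral>x. indicator T1 x * h (x, y) \<partial>lborel) = (\<integral>x. indicator {0..1} x *\<^sub>R h (x, y) \<partial>lborel)"
    proof (rule integral_cong_AE)
      have [measurable]: "(\<lambda>x. h (x, y)) \<in> borel_measurable borel"
        using cont by (intro borel_measurable_continuous_onI continuous_on_compose2[OF cont] continuous_intros) auto
      show "(\<lambda>x. indicator T1 x * h (x, y)) \<in> borel_measurable lborel"
           "(\<lambda>x. indicator {0..1} x *\<^sub>R h (x, y)) \<in> borel_measurable lborel" by measurable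
      have "AE x in lborel. x \<noteq> (1::real)" by (rule AE_lborel_singleton)
      then show "AE x in lborel. indicator T1 x * h (x, y) = indicator {0..1} x *\<^sub>R h (x, y)"
        by eventually_elim (auto simp: T1_def indicator_def)
    qed
    also have "\<dots> = integral {0..1} (\<lambda>x. h (x, y))"
      using set_borel_integral_eq_integral(2)[OF borel_integrable_atLeastAtMost'[OF cy]]
      by (simp add: set_lebesgue_integral_def)
    finally show ?thesis .
  qed
  have "(\<integral>p. h p \<partial>Leb_T2) = (\<integral>p. indicator T2 p *\<^sub>R h p \<partial>(lborel \<Otimes>\<^sub>M lborel))"
    unfolding Leb_T2_def lborel_prod by (rule integral_restrict_space) simp
  also have "\<dots> = (\<integral>y. (\<integral>x. indicator T2 (x, y) *\<^sub>R h (x, y) \<partial>lborel) \<partial>lborel)"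
    using lborel_pair.integral_snd[of "\<lambda>x y. indicator T2 (x, y) *\<^sub>R h (x, y)"] int
    by (simp add: case_prod_unfold)
  also have "\<dots> = (\<integral>y. indicator T1 y * integral {0..1} (\<lambda>x. h (x, y)) \<partial>lborel)"
    by (simp only: slice_eq)
  also have "\<bar>\<dots>\<bar> \<le> (\<integral>y. indicator T1 y * B \<partial>lborel)"
  proof (rule integral_abs_bound_integral)
    show "integrable lborel (\<lambda>y. indicator T1 y * B)"
      by (intro integrable_mult_left integrable_real_indicator) (auto simp: emeasure_T1)
    show "integrable lborel (\<lambda>y. indicator T1 y * integral {0..1} (\<lambda>x. h (x, y)))"
      using lborel_pair.integrable_snd[of "\<lambda>x y. indicator T2 (x, y) *\<^sub>R h (x, y)"] int
      by (simp only: case_prod_unfold prod.collapse slice_eq)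
  qed (use slice in \<open>auto simp: indicator_def\<close>)
  also have "\<dots> = B"
    by (simp add: measure_def emeasure_T1)
  finally show ?thesis .
qed

lemma integral_Leb_T2_indicator_fst:
  assumes "S \<in> sets borel" "S \<subseteq> T1"
  shows "(\<integral>p. indicator S (fst p) \<partial>Leb_T2) = measure lborel S"
proof -
  note [measurable] = assms(1)
  have m: "(\<lambda>p. indicator S (fst p)) \<in> borel_measurable (borel :: (real \<times> real) measure)"
    unfolding borel_prod[symmetric] by measurable
  have "(\<integral>p. indicator S (fst p) \<partial>Leb_T2) = enn2real (\<integral>\<^sup>+p. ennreal (indicator S (fst p)) \<partial>Leb_T2)"
    by (intro integral_eq_nn_integral measurable_Leb_T2 m) auto
  also have "(\<integral>\<^sup>+p. ennreal (indicator S (fst p)) \<partial>Leb_T2)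
      = (\<integral>\<^sup>+y. (\<integral>\<^sup>+x. ennreal (indicator S x) * indicator T1 x \<partial>lborel) * indicator T1 y \<partial>lborel)"
    using m by (subst nn_integral_Leb_T2(1)) auto
  also have "\<dots> = (\<integral>\<^sup>+y. emeasure lborel S * indicator T1 y \<partial>lborel)"
  proof -
    have "(\<integral>\<^sup>+x. ennreal (indicator S x) * indicator T1 x \<partial>lborel) = (\<integral>\<^sup>+x. indicator S x \<partial>lborel)"
      using assms(2) by (intro nn_integral_cong) (auto simp: indicator_def)
    then show ?thesis by simp
  qed
  also have "\<dots> = emeasure lborel S"
    by (simp add: nn_integral_cmult emeasure_T1)
  finally show ?thesis by (simp add: measure_def)
qed

definition wave :: "int \<Rightarrow> int \<Rightarrow> real \<Rightarrow> real \<times> real \<Rightarrow> real" where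
  "wave a b \<theta> p = cos (2 * pi * (of_int a * fst p + of_int b * snd p) + \<theta>)"

lemma abs_wave_le: "\<bar>wave a b \<theta> p\<bar> \<le> 1"
  by (simp add: wave_def)

lemma continuous_wave: "continuous_on UNIV (wave a b \<theta>)"
  unfolding wave_def[abs_def] by (intro continuous_intros)

lemma cos_add_int: "cos (t + 2 * pi * of_int n) = cos t"
  by (simp add: cos_add)

text \<open>Reducing modulo \<open>1\<close> after each step only changes the coordinates by integers, which the periodic \<open>f k\<close>
  do not see.\<close>

lemma comp_map_lift:
  assumes "\<And>k. 1 \<le> k \<Longrightarrow> periodic1 (f k)"
  shows "\<exists>i j::int. comp_map f n (x, y)
    = (orbit_lift f x y (Suc n) + of_int i, orbit_lift f x y n + of_int j)"
proof (induction n)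
  case 0
  show ?case by (intro exI[of _ 0]) simp
next
  case (Suc n)
  then obtain i j :: int where ij: "comp_map f n (x, y)
      = (orbit_lift f x y (Suc n) + of_int i, orbit_lift f x y n + of_int j)" by blast
  define u where "u = f (Suc n) (orbit_lift f x y (Suc n)) - (orbit_lift f x y n + of_int j)"
  have "comp_map f (Suc n) (x, y) = (frac u, orbit_lift f x y (Suc n) + of_int i)"
    using periodic1_int[OF assms, of "Suc n"] by (simp add: ij torus_map_def u_def)
  moreover have "frac u = orbit_lift f x y (Suc (Suc n)) + of_int (- j - \<lfloor>u\<rfloor>)"
    by (simp add: frac_def u_def)
  ultimately have "comp_map f (Suc n) (x, y) = (orbit_lift f x y (Suc (Suc n)) + of_int (- j - \<lfloor>u\<rfloor>),
      orbit_lift f x y (Suc n) + of_int i)" by (simp only:)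
  then show ?case by (intro exI)
qed

lemma periodic_comp_map:
  assumes "\<And>k. 1 \<le> k \<Longrightarrow> periodic1 (f k)" "periodic1 g"
  shows "g (fst (comp_map f n (x, y))) = g (orbit_lift f x y (Suc n))"
proof -
  obtain i j :: int where "comp_map f n (x, y)
      = (orbit_lift f x y (Suc n) + of_int i, orbit_lift f x y n + of_int j)"
    using comp_map_lift[of f, OF assms(1)] by blast
  then show ?thesis by (simp only: fst_conv periodic1_int[OF assms(2)])
qed

lemma cos_phase_lift:
  fixes a b a' b' :: int
  assumes "\<And>k. 1 \<le> k \<Longrightarrow> periodic1 (f k)"
  shows "cos (2 * pi * (of_int a * fst (comp_map f n (x, y)) + of_int b * snd (comp_map f n (x, y))
           + of_int a' * x + of_int b' * y) + \<theta>)
       = cos (2 * pi * (of_int a * orbit_lift f x y (Suc n) + of_int b * orbit_lift f x y n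
           + of_int a' * x + of_int b' * y) + \<theta>)"
proof -
  obtain i j :: int where ij: "comp_map f n (x, y)
      = (orbit_lift f x y (Suc n) + of_int i, orbit_lift f x y n + of_int j)"
    using comp_map_lift[of f, OF assms] by blast
  define X Y where "X = orbit_lift f x y (Suc n)" and "Y = orbit_lift f x y n"
  have "2 * pi * (of_int a * (X + of_int i) + of_int b * (Y + of_int j) + of_int a' * x + of_int b' * y) + \<theta>
      = (2 * pi * (of_int a * X + of_int b * Y + of_int a' * x + of_int b' * y) + \<theta>)
        + 2 * pi * of_int (a * i + b * j)"
    by (simp add: algebra_simps)
  then show ?thesis
    unfolding ij fst_conv snd_conv X_def[symmetric] Y_def[symmetric] by (simp only: cos_add_int)
qed

lemma continuous_orbit_lift:
  assumes "\<And>k. 1 \<le> k \<Longrightarrow> continuous_on UNIV (f k)"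
  shows "continuous_on UNIV (\<lambda>p. orbit_lift f (fst p) (snd p) n)"
proof (induction n rule: less_induct)
  case (less n)
  consider "n = 0" | "n = 1" | j where "n = Suc (Suc j)"
    by (metis One_nat_def not0_implies_Suc)
  then show ?case
  proof cases
    case 3
    show ?thesis
      unfolding 3 orbit_lift.simps
      by (intro continuous_intros continuous_on_compose2[OF assms less.IH] less.IH) (auto simp: 3)
  qed (auto intro!: continuous_intros)
qed

context steep_maps
begin

lemma continuous_f: "1 \<le> k \<Longrightarrow> continuous_on UNIV (f k)"
  by (intro continuous_at_imp_continuous_on ballI DERIV_isCont[OF diff])

lemma continuous_deriv_f: "1 \<le> k \<Longrightarrow> continuous_on UNIV (deriv (f k))"
  by (intro continuous_at_imp_continuous_on ballI DERIV_isCont[OF diff2])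

lemma measurable_f: "1 \<le> k \<Longrightarrow> f k \<in> borel_measurable borel"
  by (rule borel_measurable_continuous_onI[OF continuous_f])

lemma continuous_cutoff:
  "continuous_on UNIV (\<lambda>p. cutoff f lam n (fst p) (snd p))"
  unfolding cutoff_def
proof (rule continuous_on_prod)
  fix k assume "k \<in> {1..n}"
  then have k: "1 \<le> k" by simp
  have "continuous_on UNIV (\<lambda>p. slope f (fst p) (snd p) k)"
    by (rule continuous_on_compose2[OF continuous_deriv_f[OF k] continuous_orbit_lift[of f, OF continuous_f]])
       auto
  then have "continuous_on UNIV (\<lambda>p. slope f (fst p) (snd p) k / lam k)"
    using lam_ge[OF k] by (intro continuous_on_divide continuous_on_const) auto
  then show "continuous_on UNIV (\<lambda>p. bump (slope f (fst p) (snd p) k / lam k))"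
    by (rule continuous_on_compose2[OF continuous_bump]) auto
qed

text \<open>Split off the good orbits with the cutoff. On them the slices oscillate; the complement has small
  measure, because by invariance each point of the orbit is uniformly distributed.\<close>

lemma torus_oscillation:
  fixes a b a' b' :: int and A \<theta> :: real and \<beta> :: "nat \<Rightarrow> real"
  assumes per: "\<And>k. 1 \<le> k \<Longrightarrow> periodic1 (f k)"
    and flat: "\<And>k. 1 \<le> k \<Longrightarrow> measure lborel {x \<in> T1. \<bar>deriv (f k) x\<bar> < 2 * lam k} \<le> \<beta> k"
    and n: "1 \<le> n"
    and A: "a \<noteq> 0" "\<bar>of_int a\<bar> \<le> A" "\<bar>of_int b\<bar> \<le> A" "\<bar>of_int a'\<bar> \<le> A" "16 * A \<le> lam n"
  shows "\<bar>\<integral>p. cos (2 * pi * (of_int a * fst (comp_map f n p) + of_int b * snd (comp_map f n p)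
            + of_int a' * fst p + of_int b' * snd p) + \<theta>) \<partial>Leb_T2\<bar>
    \<le> c * (3 + 2 * A) + (\<Sum>k=1..n. \<beta> k)"
proof -
  define u where "u = (\<lambda>p. cos (2 * pi * (of_int a * orbit_lift f (fst p) (snd p) (Suc n)
    + of_int b * orbit_lift f (fst p) (snd p) n + of_int a' * fst p + of_int b' * snd p) + \<theta>))"
  define X where "X = (\<lambda>p. cutoff f lam n (fst p) (snd p))"
  have cu: "continuous_on UNIV u"
    unfolding u_def by (intro continuous_intros continuous_orbit_lift[of f] continuous_f)
  have cX: "continuous_on UNIV X"
    unfolding X_def by (rule continuous_cutoff)
  have meas: "h \<in> borel_measurable Leb_T2" if "continuous_on UNIV h" for h :: "real \<times> real \<Rightarrow> real"
    by (rule measurable_Leb_T2[OF borel_measurable_continuous_onI[OF that]])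
  have u1: "\<bar>u p\<bar> \<le> 1" for p by (simp add: u_def)
  have X01: "0 \<le> X p" "X p \<le> 1" for p by (simp_all add: X_def cutoff_bounds)
  have Xu1: "\<bar>X p * u p\<bar> \<le> 1 * 1" for p
    unfolding abs_mult using u1 X01 by (intro mult_mono) auto
  have X1u1: "\<bar>(1 - X p) * u p\<bar> \<le> (1 - X p) * 1" for p
    unfolding abs_mult using u1 X01[of p] by (intro mult_mono) auto
  have iX: "integrable Leb_T2 (\<lambda>p. X p * u p)"
    by (rule integrable_Leb_T2[OF meas Xu1]) (intro continuous_on_mult cu cX)
  have i1X: "integrable Leb_T2 (\<lambda>p. (1 - X p) * u p)"
  proof (rule integrable_Leb_T2[OF meas])
    show "continuous_on UNIV (\<lambda>p. (1 - X p) * u p)"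
      by (intro continuous_on_mult continuous_on_diff continuous_on_const cu cX)
    show "\<bar>(1 - X p) * u p\<bar> \<le> 1" for p
      using X01[of p] by (intro order.trans[OF X1u1]) simp
  qed
  have "(\<integral>p. cos (2 * pi * (of_int a * fst (comp_map f n p) + of_int b * snd (comp_map f n p)
            + of_int a' * fst p + of_int b' * snd p) + \<theta>) \<partial>Leb_T2) = (\<integral>p. u p \<partial>Leb_T2)"
  proof (rule Bochner_Integration.integral_cong[OF refl])
    fix p :: "real \<times> real"
    obtain x y where p: "p = (x, y)" by (cases p)
    show "cos (2 * pi * (of_int a * fst (comp_map f n p) + of_int b * snd (comp_map f n p)
            + of_int a' * fst p + of_int b' * snd p) + \<theta>) = u p"
      unfolding u_def p fst_conv snd_conv by (rule cos_phase_lift[of f, OF per])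
  qed
  also have "\<dots> = (\<integral>p. X p * u p + (1 - X p) * u p \<partial>Leb_T2)"
    by (simp add: algebra_simps)
  also have "\<dots> = (\<integral>p. X p * u p \<partial>Leb_T2) + (\<integral>p. (1 - X p) * u p \<partial>Leb_T2)"
    by (rule Bochner_Integration.integral_add[OF iX i1X])
  finally have split: "(\<integral>p. cos (2 * pi * (of_int a * fst (comp_map f n p)
      + of_int b * snd (comp_map f n p) + of_int a' * fst p + of_int b' * snd p) + \<theta>) \<partial>Leb_T2)
    = (\<integral>p. X p * u p \<partial>Leb_T2) + (\<integral>p. (1 - X p) * u p \<partial>Leb_T2)" .
  have "\<bar>\<integral>p. X p * u p \<partial>Leb_T2\<bar> \<le> c * (3 + 2 * A)"
  proof (rule integral_Leb_T2_slices)
    show "continuous_on UNIV (\<lambda>p. X p * u p)" by (intro continuous_on_mult cu cX)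
    show "\<bar>X p * u p\<bar> \<le> 1 * 1" for p by (rule Xu1)
    show "\<bar>integral {0..1} (\<lambda>x. X (x, y) * u (x, y))\<bar> \<le> c * (3 + 2 * A)" for y
      unfolding X_def u_def fst_conv snd_conv
      by (rule oscillation[OF n]) (use A in auto)
  qed
  moreover have "\<bar>\<integral>p. (1 - X p) * u p \<partial>Leb_T2\<bar> \<le> (\<Sum>k=1..n. \<beta> k)"
  proof -
    define s where "s = (\<lambda>k x. 1 - bump (deriv (f k) x / lam k))"
    have cs: "continuous_on UNIV (s k)" if "1 \<le> k" for k
    proof -
      have "continuous_on UNIV (\<lambda>x. deriv (f k) x / lam k)"
        using lam_ge[OF that] by (intro continuous_on_divide continuous_on_const continuous_deriv_f that) auto
      then have "continuous_on UNIV (\<lambda>x. bump (deriv (f k) x / lam k))"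
        by (rule continuous_on_compose2[OF continuous_bump]) auto
      then show ?thesis
        unfolding s_def by (intro continuous_on_diff continuous_on_const)
    qed
    have s01: "0 \<le> s k x" "s k x \<le> 1" for k x by (simp_all add: s_def bump_bounds)
    have ms: "(\<lambda>p. s k (fst p)) \<in> borel_measurable Leb_T2" if "1 \<le> k" for k
      by (intro meas continuous_on_compose2[OF cs[OF that] continuous_on_fst[OF continuous_on_id]]) auto
    have mcs: "(\<lambda>p. s k (fst (comp_map f m p))) \<in> borel_measurable Leb_T2" if "1 \<le> k" for k m
      using measurable_compose[OF measurable_comp_map[of f, OF measurable_f] ms[OF that]] by simp
    \<comment> \<open>The \<open>k\<close>-th slope is taken at the first coordinate of the orbit at time \<open>k - 1\<close>.\<close>
    have pw: "\<bar>(1 - X p) * u p\<bar> \<le> (\<Sum>k=1..n. s k (fst (comp_map f (k - 1) p)))" for p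
    proof -
      obtain x y where p: "p = (x, y)" by (cases p)
      have "\<bar>(1 - X p) * u p\<bar> \<le> (1 - X p) * 1"
        by (rule X1u1)
      also have "\<dots> \<le> (\<Sum>k=1..n. 1 - bump (slope f x y k / lam k))"
        using one_minus_cutoff_le[of f lam n x y] by (simp add: X_def p)
      also have "\<dots> = (\<Sum>k=1..n. s k (fst (comp_map f (k - 1) p)))"
      proof (rule sum.cong[OF refl])
        fix k assume "k \<in> {1..n}"
        then obtain m where k: "k = Suc m" by (cases k) auto
        have "periodic1 (deriv (f k))" using per diff by (intro periodic1_deriv) (auto simp: k)
        from periodic_comp_map[of f "deriv (f k)" m x y, OF per this]
        show "1 - bump (slope f x y k / lam k) = s k (fst (comp_map f (k - 1) p))"
          by (simp add: s_def k p)
      qed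
      finally show ?thesis .
    qed
    have ints: "integrable Leb_T2 (\<lambda>p. s k (fst (comp_map f m p)))" if "1 \<le> k" for k m
      using s01 by (intro integrable_Leb_T2[where b = 1] mcs that) auto
    have "\<bar>\<integral>p. (1 - X p) * u p \<partial>Leb_T2\<bar> \<le> (\<integral>p. (\<Sum>k=1..n. s k (fst (comp_map f (k - 1) p))) \<partial>Leb_T2)"
    proof (rule integral_abs_bound_integral)
      show "integrable Leb_T2 (\<lambda>p. \<Sum>k=1..n. s k (fst (comp_map f (k - 1) p)))"
        by (intro Bochner_Integration.integrable_sum ints) auto
    qed (rule pw i1X)+
    also have "\<dots> = (\<Sum>k=1..n. \<integral>p. s k (fst (comp_map f (k - 1) p)) \<partial>Leb_T2)"
      by (rule Bochner_Integration.integral_sum) (auto intro!: ints)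
    also have "\<dots> \<le> (\<Sum>k=1..n. \<beta> k)"
    proof (rule sum_mono)
      fix k assume "k \<in> {1..n}"
      then have k: "1 \<le> k" by simp
      define S where "S = {x \<in> T1. \<bar>deriv (f k) x\<bar> < 2 * lam k}"
      have [measurable]: "deriv (f k) \<in> borel_measurable borel"
        by (rule borel_measurable_continuous_onI[OF continuous_deriv_f[OF k]])
      have S: "S \<in> sets borel" unfolding S_def by measurable
      have "(\<integral>p. s k (fst (comp_map f (k - 1) p)) \<partial>Leb_T2) = (\<integral>p. s k (fst p) \<partial>Leb_T2)"
        by (rule integral_comp_map[of f "\<lambda>p. s k (fst p)", OF measurable_f ms[OF k]])
      also have "\<dots> \<le> (\<integral>p. indicator S (fst p) \<partial>Leb_T2)"
      proof (rule integral_mono)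
        show "integrable Leb_T2 (\<lambda>p. s k (fst p))"
          using ints[OF k, of 0] by simp
        have "(\<lambda>p. indicator S (fst p) :: real) \<in> borel_measurable (borel \<Otimes>\<^sub>M (borel :: real measure))"
          using S by measurable
        then show "integrable Leb_T2 (\<lambda>p. indicator S (fst p) :: real)"
          unfolding borel_prod
          by (intro integrable_Leb_T2[where b = 1] measurable_Leb_T2) (auto simp: indicator_def)
        fix p assume "p \<in> space Leb_T2"
        then have p: "fst p \<in> T1" by (auto simp: T2_def)
        show "s k (fst p) \<le> indicator S (fst p)"
        proof (cases "fst p \<in> S")
          case False
          then have "2 \<le> \<bar>deriv (f k) (fst p) / lam k\<bar>"
            using p lam_ge[OF k] by (simp add: S_def field_simps)
          then show ?thesis by (simp add: s_def bump_eq_1)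
        qed (simp add: s01)
      qed
      also have "\<dots> = measure lborel S"
        by (rule integral_Leb_T2_indicator_fst[OF S]) (auto simp: S_def)
      also have "\<dots> \<le> \<beta> k" unfolding S_def by (rule flat[OF k])
      finally show "(\<integral>p. s k (fst (comp_map f (k - 1) p)) \<partial>Leb_T2) \<le> \<beta> k" .
    qed
    finally show ?thesis .
  qed
  ultimately show ?thesis unfolding split by linarith
qed

text \<open>If \<open>a = 0\<close> the phase does not see the last coordinate \<open>x\<^sub>n\<close>, but since the second coordinate is the previous first
  one, the bound at time \<open>n - 1\<close> applies. This is why two steps are needed before correlations decay.\<close>

lemma wave_correlation:
  fixes a b :: int and A \<theta> :: real and \<beta> :: "nat \<Rightarrow> real"
  assumes per: "\<And>k. 1 \<le> k \<Longrightarrow> periodic1 (f k)"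
    and flat: "\<And>k. 1 \<le> k \<Longrightarrow> measure lborel {x \<in> T1. \<bar>deriv (f k) x\<bar> < 2 * lam k} \<le> \<beta> k"
    and n: "2 \<le> n"
    and ab: "(a, b) \<noteq> (0, 0)" "\<bar>of_int a\<bar> \<le> A" "\<bar>of_int b\<bar> \<le> A" "\<And>k. 1 \<le> k \<Longrightarrow> 16 * A \<le> lam k"
  shows "\<bar>\<integral>p. wave a b \<theta> p * wave a b \<theta> (comp_map f n p) \<partial>Leb_T2\<bar>
    \<le> c * (3 + 2 * A) + (\<Sum>k=1..n. \<beta> k)"
proof -
  define R where "R = c * (3 + 2 * A) + (\<Sum>k=1..n. \<beta> k)"
  have \<beta>: "0 \<le> \<beta> k" if "1 \<le> k" for k
    using flat[OF that] measure_nonneg order.trans by blast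
  define I where "I = (\<lambda>a' b' \<theta>' p. cos (2 * pi * (of_int a * fst (comp_map f n p)
    + of_int b * snd (comp_map f n p) + of_int a' * fst p + of_int b' * snd p) + \<theta>'))"
  have I: "\<bar>\<integral>p. I a' b' \<theta>' p \<partial>Leb_T2\<bar> \<le> R" if "\<bar>of_int a'\<bar> \<le> A" for a' b' :: int and \<theta>'
  proof (cases "a = 0")
    case False
    then show ?thesis
      unfolding I_def R_def using that n ab by (intro torus_oscillation per flat) auto
  next
    case True
    obtain m where m: "n = Suc m" "1 \<le> m" using n by (cases n) auto
    have "snd (comp_map f n p) = fst (comp_map f m p)" for p
      by (simp add: m torus_map_def case_prod_unfold)
    then have "\<bar>\<integral>p. I a' b' \<theta>' p \<partial>Leb_T2\<bar> = \<bar>\<integral>p. cos (2 * pi * (of_int b * fst (comp_map f m p)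
        + of_int 0 * snd (comp_map f m p) + of_int a' * fst p + of_int b' * snd p) + \<theta>') \<partial>Leb_T2\<bar>"
      by (simp add: I_def True)
    also have "\<dots> \<le> c * (3 + 2 * A) + (\<Sum>k=1..m. \<beta> k)"
      using that ab m True by (intro torus_oscillation per flat) auto
    also have "\<dots> \<le> R"
      unfolding R_def m using \<beta> by simp
    finally show ?thesis .
  qed
  have prod: "wave a b \<theta> p * wave a b \<theta> (comp_map f n p)
      = (I (- a) (- b) 0 p + I a b (2 * \<theta>) p) / 2" for p
    unfolding wave_def cos_times_cos I_def
    by (subst cos_minus[symmetric]) (simp add: algebra_simps)
  have intI: "integrable Leb_T2 (I a' b' \<theta>')" for a' b' \<theta>'
  proof (rule integrable_Leb_T2[where b = 1])
    have "(\<lambda>q. cos (2 * pi * (of_int a * fst (fst q) + of_int b * snd (fst q)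
        + of_int a' * fst (snd q) + of_int b' * snd (snd q)) + \<theta>'))
        \<in> borel_measurable (borel :: ((real \<times> real) \<times> (real \<times> real)) measure)"
      by (intro borel_measurable_continuous_onI continuous_intros)
    moreover have "(\<lambda>p. p) \<in> borel_measurable Leb_T2"
      by (rule measurable_Leb_T2) simp
    moreover from measurable_compose[OF measurable_comp_map[of f, OF measurable_f] this]
    have "comp_map f n \<in> borel_measurable Leb_T2" by simp
    ultimately have "(\<lambda>p. (\<lambda>q. cos (2 * pi * (of_int a * fst (fst q) + of_int b * snd (fst q)
        + of_int a' * fst (snd q) + of_int b' * snd (snd q)) + \<theta>')) (comp_map f n p, p))
        \<in> borel_measurable Leb_T2"
      by (intro measurable_compose[OF borel_measurable_Pair])
    then show "I a' b' \<theta>' \<in> borel_measurable Leb_T2"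
      by (simp add: I_def)
  qed (simp add: I_def)
  have mean: "\<bar>(s + t) / 2\<bar> \<le> R" if "\<bar>s\<bar> \<le> R" "\<bar>t\<bar> \<le> R" for s t :: real
    using that by (auto simp: abs_le_iff)
  have "(\<integral>p. wave a b \<theta> p * wave a b \<theta> (comp_map f n p) \<partial>Leb_T2)
      = ((\<integral>p. I (- a) (- b) 0 p \<partial>Leb_T2) + (\<integral>p. I a b (2 * \<theta>) p \<partial>Leb_T2)) / 2"
    unfolding prod using intI by simp
  moreover have "\<bar>\<integral>p. I (- a) (- b) 0 p \<partial>Leb_T2\<bar> \<le> R" "\<bar>\<integral>p. I a b (2 * \<theta>) p \<partial>Leb_T2\<bar> \<le> R"
    using ab by (auto intro!: I)
  ultimately show ?thesis unfolding R_def[symmetric] by (simp only: mean)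
qed

end

text \<open>With \<open>w k = L\<^sub>k\<^sup>1\<^sup>/\<^sup>4\<close> the slope threshold is \<open>w k ^ 3\<close>. Then \<open>f\<^sub>k'' / (w k ^ 3)\<^sup>2\<close> is of order
  \<open>1 / (w k)\<^sup>2\<close>, and the excluded neighbourhoods of the critical points have radius \<open>2 K1 / w k\<close>.\<close>

lemma admissible_wave_correlation:
  fixes a b :: int and A K0 K1 \<theta> :: real and w :: "nat \<Rightarrow> real"
  assumes adm: "\<And>k. 1 \<le> k \<Longrightarrow> admissible K0 K1 M0 (w k ^ 4) (f k)"
    and K: "0 < K0" "0 < K1"
    and w: "1 \<le> w 1" "16 * A \<le> w 1" "16 \<le> w 1" "2 * K1 \<le> w 1" "\<And>k. 1 \<le> k \<Longrightarrow> w 1 \<le> w k"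
    and n: "2 \<le> n"
    and ab: "(a, b) \<noteq> (0, 0)" "\<bar>of_int a\<bar> \<le> A" "\<bar>of_int b\<bar> \<le> A"
  shows "\<bar>\<integral>p. wave a b \<theta> p * wave a b \<theta> (comp_map f n p) \<partial>Leb_T2\<bar>
    \<le> (64 * K0 + 1) / (w 1)\<^sup>2 * (3 + 2 * A) + (\<Sum>k=1..n. 12 * real M0 * K1 / w k)"
proof -
  have w_pos: "1 \<le> w k" "0 < w k" if "1 \<le> k" for k
    using w(1) w(5)[OF that] by linarith+
  have cube: "w k \<le> w k ^ 3" if "1 \<le> k" for k
    using power_increasing[of 1 3 "w k"] w_pos[OF that] by simp
  interpret steep_maps f "\<lambda>k. w k ^ 3" "\<lambda>k. K0 * w k ^ 4" "(64 * K0 + 1) / (w 1)\<^sup>2"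
  proof
    fix k :: nat and z :: real
    assume k: "1 \<le> k"
    show "(f k has_real_derivative deriv (f k) z) (at z)"
      "(deriv (f k) has_real_derivative deriv (deriv (f k)) z) (at z)"
      using admissible_DERIV[OF adm[OF k]] by auto
    show "\<bar>deriv (deriv (f k)) z\<bar> \<le> K0 * w k ^ 4"
      by (rule admissible_deriv2_le[OF adm[OF k]])
    show "16 \<le> w k ^ 3" using w(3) w(5)[OF k] cube[OF k] by linarith
    have sq: "(w 1)\<^sup>2 \<le> (w k)\<^sup>2" using w(5)[OF k] w(1) by (intro power_mono) auto
    have "64 * K0 * (w 1)\<^sup>2 \<le> (64 * K0 + 1) * (w k)\<^sup>2"
      using sq K by (intro mult_mono) auto
    then have "w k ^ 4 * (64 * K0 * (w 1)\<^sup>2) \<le> w k ^ 4 * ((64 * K0 + 1) * (w k)\<^sup>2)"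
      by (intro mult_left_mono) auto
    then show "64 * (K0 * w k ^ 4) \<le> (64 * K0 + 1) / (w 1)\<^sup>2 * (w k ^ 3)\<^sup>2"
      using w(1) by (simp add: field_simps flip: power_mult power_add)
    have "1 * (w 1)\<^sup>2 \<le> (64 * K0 + 1) * (w k)\<^sup>2"
      using sq K by (intro mult_mono) auto
    also have "\<dots> \<le> (64 * K0 + 1) * w k ^ 3"
      using w_pos[OF k] K by (intro mult_left_mono power_increasing) auto
    finally show "1 \<le> (64 * K0 + 1) / (w 1)\<^sup>2 * w k ^ 3"
      using w(1) by (simp add: field_simps)
  qed
  show ?thesis
  proof (rule wave_correlation[OF _ _ n ab])
    fix k :: nat assume k: "1 \<le> k"
    show "periodic1 (f k)" by (rule admissible_periodic[OF adm[OF k]])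
    show "16 * A \<le> w k ^ 3" using w(2) w(5)[OF k] cube[OF k] by linarith
    have r: "0 \<le> 2 * K1 / w k" "2 * K1 / w k \<le> 1"
      using w(4) w(5)[OF k] w_pos[OF k] K by (auto simp: field_simps)
    have "w k ^ 4 * inverse K1 * (2 * K1 / w k) = 2 * w k ^ 3"
      using K w_pos[OF k] by (simp add: field_simps power_eq_if)
    then show "measure lborel {x \<in> T1. \<bar>deriv (f k) x\<bar> < 2 * w k ^ 3} \<le> 12 * real M0 * K1 / w k"
      using measure_near_critical[OF adm[OF k] _ K(2) r] w_pos[OF k] by simp
  qed
qed

lemma sum_inverse_cubes_le:
  assumes "1 \<le> i"
  shows "(\<Sum>k=1..n. 1 / real (k + i) ^ 3) \<le> 1 / (real i)\<^sup>2 - 1 / (real (n + i))\<^sup>2"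
proof (induction n)
  case (Suc n)
  define m where "m = real (n + i)"
  have m: "1 \<le> m" using assms by (simp add: m_def)
  have "1 / (m + 1) ^ 3 \<le> 1 / m\<^sup>2 - 1 / (m + 1)\<^sup>2"
  proof -
    obtain v where v: "v = m + 1" by blast
    have "0 < m" "0 < v" using m v by auto
    have "v\<^sup>2 - m\<^sup>2 = m + v" by (simp add: v power2_eq_square algebra_simps)
    then have "1 / m\<^sup>2 - 1 / v\<^sup>2 = (m + v) / (m\<^sup>2 * v\<^sup>2)"
      using \<open>0 < m\<close> \<open>0 < v\<close> by (simp add: diff_frac_eq)
    moreover have "1 / v ^ 3 = (m\<^sup>2 / v) / (m\<^sup>2 * v\<^sup>2)"
      using \<open>0 < m\<close> \<open>0 < v\<close> by (simp add: field_simps power_eq_if)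
    moreover have "m\<^sup>2 / v \<le> m + v"
      using m by (simp add: v field_simps power2_eq_square)
    ultimately have "1 / v ^ 3 \<le> 1 / m\<^sup>2 - 1 / v\<^sup>2"
      using \<open>0 < m\<close> \<open>0 < v\<close> by (simp only:) (intro divide_right_mono, auto)
    then show ?thesis by (simp only: v)
  qed
  with Suc show ?case by (simp add: m_def add_ac)
qed simp

lemma comp_map_correlation_shift:
  fixes \<psi> :: "real \<times> real \<Rightarrow> real"
  assumes "\<And>k. 1 \<le> k \<Longrightarrow> f k \<in> borel_measurable borel" and "\<psi> \<in> borel_measurable Leb_T2"
  shows "(\<integral>p. \<psi> (comp_map f i p) * \<psi> (comp_map f (n + i) p) \<partial>Leb_T2)
    = (\<integral>p. \<psi> p * \<psi> (comp_map (\<lambda>k. f (k + i)) n p) \<partial>Leb_T2)"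
proof -
  have "(\<lambda>p. \<psi> p * \<psi> (comp_map (\<lambda>k. f (k + i)) n p)) \<in> borel_measurable Leb_T2"
  proof (intro borel_measurable_times assms(2))
    have "comp_map (\<lambda>k. f (k + i)) n \<in> measurable Leb_T2 Leb_T2"
      by (rule measurable_comp_map) (simp add: assms(1))
    then show "(\<lambda>p. \<psi> (comp_map (\<lambda>k. f (k + i)) n p)) \<in> borel_measurable Leb_T2"
      by (rule measurable_compose) (rule assms(2))
  qed
  from integral_comp_map[of f, OF assms(1) this, of i]
  show ?thesis by (simp add: comp_map_add)
qed

text \<open>For large \<open>i\<close> the shifted sequence of maps satisfies the lower bounds on the parameters, and
  \<open>\<Sum>\<^sub>k 1 / w (k + i)\<close> is at most \<open>\<Sum>\<^sub>k 1 / (k + i)\<^sup>3 \<le> 1 / i\<^sup>2\<close>. The finitely many small \<open>i\<close> are absorbed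
  into the constant.\<close>

lemma wave_correlation_decay:
  fixes a b :: int and K0 K1 \<theta> :: real and w :: "nat \<Rightarrow> real"
  assumes adm: "\<And>k. 1 \<le> k \<Longrightarrow> admissible K0 K1 M0 (w k ^ 4) (f k)"
    and K: "0 < K0" "0 < K1"
    and mono: "mono_on {1..} w"
    and big: "\<forall>\<^sub>F k in sequentially. real k ^ 3 \<le> w k"
    and ab: "(a, b) \<noteq> (0, 0)"
  shows "\<exists>C\<ge>0. \<forall>i j. i + 2 \<le> j \<longrightarrow>
    \<bar>\<integral>p. wave a b \<theta> (comp_map f i p) * wave a b \<theta> (comp_map f j p) \<partial>Leb_T2\<bar> \<le> C / (real (i + 1))\<^sup>2"
proof -
  define A where "A = max \<bar>real_of_int a\<bar> \<bar>real_of_int b\<bar>"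
  have A: "0 \<le> A" "\<bar>real_of_int a\<bar> \<le> A" "\<bar>real_of_int b\<bar> \<le> A" by (auto simp: A_def)
  have fm: "f k \<in> borel_measurable borel" if "1 \<le> k" for k
    by (rule borel_measurable_continuous_onI[OF admissible_continuous(1)[OF adm[OF that]]])
  have wm: "wave a b \<theta> \<in> borel_measurable Leb_T2"
    by (rule measurable_Leb_T2[OF borel_measurable_continuous_onI[OF continuous_wave]])
  obtain k0 where k0: "\<And>k. k0 \<le> k \<Longrightarrow> real k ^ 3 \<le> w k"
    using big by (auto simp: eventually_sequentially)
  obtain k1 :: nat where k1: "max (16 * A) (max 16 (2 * K1)) \<le> real k1"
    using real_arch_simple by blast
  \<comment> \<open>From \<open>i1\<close> on, \<open>w\<close> exceeds the thresholds; the summand \<open>1\<close> keeps \<open>i\<close> positive.\<close>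
  define i1 where "i1 = k0 + k1 + 1"
  define C where "C = (real (i1 + 1))\<^sup>2 + (64 * K0 + 1) * (3 + 2 * A) + 48 * real M0 * K1"
  have parts: "0 \<le> (64 * K0 + 1) * (3 + 2 * A)" "0 \<le> 48 * real M0 * K1"
    using K A by auto
  then have C: "0 \<le> C" "(real (i1 + 1))\<^sup>2 \<le> C"
      "(64 * K0 + 1) * (3 + 2 * A) + 48 * real M0 * K1 \<le> C"
    unfolding C_def by auto
  have "\<bar>\<integral>p. wave a b \<theta> (comp_map f i p) * wave a b \<theta> (comp_map f j p) \<partial>Leb_T2\<bar> \<le> C / (real (i + 1))\<^sup>2"
    if ij: "i + 2 \<le> j" for i j
  proof (cases "i1 \<le> i")
    case False
    have "\<bar>\<integral>p. wave a b \<theta> (comp_map f i p) * wave a b \<theta> (comp_map f j p) \<partial>Leb_T2\<bar> \<le> (\<integral>p. 1 \<partial>Leb_T2)"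
    proof (rule integral_abs_bound_integral)
      have "\<bar>wave a b \<theta> p * wave a b \<theta> q\<bar> \<le> 1 * 1" for p q
        unfolding abs_mult by (intro mult_mono abs_wave_le) auto
      then show le: "\<bar>wave a b \<theta> (comp_map f i p) * wave a b \<theta> (comp_map f j p)\<bar> \<le> 1" for p
        by simp
      show "integrable Leb_T2 (\<lambda>p. wave a b \<theta> (comp_map f i p) * wave a b \<theta> (comp_map f j p))"
        by (intro integrable_Leb_T2[OF _ le] borel_measurable_times
            measurable_compose[OF measurable_comp_map[of f, OF fm] wm])
      show "integrable Leb_T2 (\<lambda>p. 1 :: real)"
        by (rule integrable_Leb_T2[where b = 1]) auto
    qed
    also have "\<dots> = 1" by (simp add: measure_Leb_T2)
    also have "1 \<le> C / (real (i + 1))\<^sup>2"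
    proof -
      have "(real (i + 1))\<^sup>2 \<le> (real (i1 + 1))\<^sup>2" using False by (intro power_mono) auto
      then have "(real (i + 1))\<^sup>2 \<le> C" using C(2) by (rule order.trans)
      then show ?thesis by (simp add: divide_simps)
    qed
    finally show ?thesis .
  next
    case True
    obtain n where n: "j = n + i" "2 \<le> n" using ij by (intro that[of "j - i"]) auto
    define v where "v = (\<lambda>k. w (k + i))"
    have v_ge: "real (k + i) ^ 3 \<le> v k" for k
      unfolding v_def using True by (intro k0) (simp add: i1_def)
    have v1: "real k1 \<le> v 1" "(real (i + 1))\<^sup>2 \<le> v 1" "1 \<le> v 1"
    proof -
      have i: "1 \<le> real (1 + i)" by simp
      have "real k1 \<le> real (1 + i) ^ 1" using True by (simp add: i1_def)
      also have "\<dots> \<le> real (1 + i) ^ 3" by (rule power_increasing[OF _ i]) simp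
      finally show "real k1 \<le> v 1" using v_ge[of 1] by linarith
      have "real (1 + i) ^ 2 \<le> real (1 + i) ^ 3" by (rule power_increasing[OF _ i]) simp
      then show "(real (i + 1))\<^sup>2 \<le> v 1" using v_ge[of 1] by (simp add: add.commute)
      have "1 \<le> real (1 + i) ^ 3" by (rule one_le_power[OF i])
      then show "1 \<le> v 1" using v_ge[of 1] by linarith
    qed
    have "\<bar>\<integral>p. wave a b \<theta> p * wave a b \<theta> (comp_map (\<lambda>k. f (k + i)) n p) \<partial>Leb_T2\<bar>
      \<le> (64 * K0 + 1) / (v 1)\<^sup>2 * (3 + 2 * A) + (\<Sum>k=1..n. 12 * real M0 * K1 / v k)"
    proof (rule admissible_wave_correlation[OF _ K _ _ _ _ _ n(2) ab A(2,3)])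
      show "admissible K0 K1 M0 (v k ^ 4) (f (k + i))" if "1 \<le> k" for k
        unfolding v_def using that by (intro adm) simp
      show "v 1 \<le> v k" if "1 \<le> k" for k
        unfolding v_def using that by (intro mono_onD[OF mono]) auto
    qed (use v1 k1 in auto)
    also have "(64 * K0 + 1) / (v 1)\<^sup>2 * (3 + 2 * A) \<le> (64 * K0 + 1) * (3 + 2 * A) / (real (i + 1))\<^sup>2"
    proof -
      have "v 1 ^ 1 \<le> (v 1)\<^sup>2" using v1(3) by (intro power_increasing) auto
      then have "(real (i + 1))\<^sup>2 \<le> (v 1)\<^sup>2" using v1(2) by simp
      then have "(64 * K0 + 1) * (3 + 2 * A) / (v 1)\<^sup>2 \<le> (64 * K0 + 1) * (3 + 2 * A) / (real (i + 1))\<^sup>2"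
        using parts(1) by (intro divide_left_mono) (use v1(3) in auto)
      then show ?thesis by simp
    qed
    also have "(\<Sum>k=1..n. 12 * real M0 * K1 / v k) \<le> 48 * real M0 * K1 / (real (i + 1))\<^sup>2"
    proof -
      have i: "1 \<le> i" using True by (simp add: i1_def)
      have "(\<Sum>k=1..n. 12 * real M0 * K1 / v k) \<le> (\<Sum>k=1..n. 12 * real M0 * K1 * (1 / real (k + i) ^ 3))"
      proof (rule sum_mono)
        fix k
        have "12 * real M0 * K1 / v k \<le> 12 * real M0 * K1 / real (k + i) ^ 3"
        proof (rule divide_left_mono[OF v_ge])
          have "0 < real (k + i) ^ 3" using i by simp
          with v_ge[of k] show "0 < v k * real (k + i) ^ 3" by (intro mult_pos_pos) linarith+
        qed (use parts in auto)
        then show "12 * real M0 * K1 / v k \<le> 12 * real M0 * K1 * (1 / real (k + i) ^ 3)" by simp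
      qed
      also have "\<dots> = 12 * real M0 * K1 * (\<Sum>k=1..n. 1 / real (k + i) ^ 3)"
        by (rule sum_distrib_left[symmetric])
      also have "\<dots> \<le> 12 * real M0 * K1 * (4 / (real (i + 1))\<^sup>2)"
      proof (rule mult_left_mono)
        have "(\<Sum>k=1..n. 1 / real (k + i) ^ 3) \<le> 1 / (real i)\<^sup>2"
          using sum_inverse_cubes_le[OF i, of n] by (rule order.trans) simp
        also have "\<dots> \<le> 4 / (real (i + 1))\<^sup>2"
        proof -
          have "(real (i + 1))\<^sup>2 \<le> (2 * real i)\<^sup>2" using i by (intro power_mono) auto
          then show ?thesis using i by (simp add: field_simps power_mult_distrib)
        qed
        finally show "(\<Sum>k=1..n. 1 / real (k + i) ^ 3) \<le> 4 / (real (i + 1))\<^sup>2" .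
      qed (use parts in auto)
      finally show ?thesis by simp
    qed
    also have "(64 * K0 + 1) * (3 + 2 * A) / (real (i + 1))\<^sup>2 + 48 * real M0 * K1 / (real (i + 1))\<^sup>2
        \<le> C / (real (i + 1))\<^sup>2"
      unfolding add_divide_distrib[symmetric] using C(3) by (intro divide_right_mono) auto
    finally show ?thesis
      using comp_map_correlation_shift[of f "wave a b \<theta>" i n, OF fm wm] by (simp add: n)
  qed
  with C(1) show ?thesis by blast
qed

section \<open>Law of large numbers\<close>

lemma sum_inverse_squares_le: "(\<Sum>i<n. 1 / (real (i + 1))\<^sup>2) \<le> 2"
proof -
  have "(\<Sum>i<n. 1 / (real (i + 1))\<^sup>2) \<le> 2 - 1 / real n"
  proof (induction n)
    case (Suc n)
    show ?case
    proof (cases "n = 0")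
      case False
      have "1 / real n - 1 / real (n + 1) = 1 / (real n * real (n + 1))"
        using False by (simp add: diff_frac_eq)
      moreover have "real n * real (n + 1) \<le> (real (n + 1))\<^sup>2"
        unfolding power2_eq_square by (intro mult_right_mono) auto
      ultimately have "1 / (real (n + 1))\<^sup>2 \<le> 1 / real n - 1 / real (n + 1)"
        using False by (simp only:) (intro divide_left_mono, auto)
      with Suc have "(\<Sum>i<n. 1 / (real (i + 1))\<^sup>2) + 1 / (real (n + 1))\<^sup>2 \<le> 2 - 1 / real (n + 1)"
        by linarith
      then show ?thesis by simp
    qed simp
  qed simp
  then show ?thesis by (rule order.trans) simp
qed

text \<open>Passing from \<open>N\<close> to \<open>N + 1\<close> adds the correlations of the new term with all previous ones; their sum is
  bounded because \<open>\<Sum>\<^sub>i 1 / (i + 1)\<^sup>2\<close> converges. Only the immediate predecessor has no decay, and it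
  contributes at most \<open>1\<close>.\<close>

lemma second_moment_of_decaying_correlations:
  fixes \<psi> :: "nat \<Rightarrow> 'a \<Rightarrow> real"
  assumes M: "emeasure M (space M) = 1"
    and meas: "\<And>i. \<psi> i \<in> borel_measurable M" and b: "\<And>i x. \<bar>\<psi> i x\<bar> \<le> 1"
    and C: "0 \<le> C" "\<And>i j. i + 2 \<le> j \<Longrightarrow> \<bar>\<integral>x. \<psi> i x * \<psi> j x \<partial>M\<bar> \<le> C / (real (i + 1))\<^sup>2"
  shows "(\<integral>x. (\<Sum>i\<le>N. \<psi> i x)\<^sup>2 \<partial>M) \<le> (4 * C + 3) * real (N + 1)"
proof (induction N)
  have fin: "finite_measure M" by (rule finite_measureI) (simp add: M)
  have bb: "\<bar>\<psi> i x * \<psi> j x\<bar> \<le> 1" for i j x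
    unfolding abs_mult using mult_mono[OF b[of i x] b[of j x]] by simp
  have int: "integrable M (\<lambda>x. \<psi> i x * \<psi> j x)" for i j
    using bb by (intro finite_measure.integrable_const_bound[OF fin, of _ 1] AE_I2)
      (auto intro!: borel_measurable_times meas)
  have one: "\<bar>\<integral>x. \<psi> i x * \<psi> j x \<partial>M\<bar> \<le> 1" for i j
  proof -
    have "\<bar>\<integral>x. \<psi> i x * \<psi> j x \<partial>M\<bar> \<le> (\<integral>x. 1 \<partial>M)"
    proof (rule order.trans[OF integral_abs_bound integral_mono])
      show "integrable M (\<lambda>x. \<bar>\<psi> i x * \<psi> j x\<bar>)" by (rule integrable_abs[OF int])
      show "integrable M (\<lambda>x. 1 :: real)" by (rule finite_measure.integrable_const[OF fin])
    qed (rule bb)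
    then show ?thesis by (simp add: measure_def M)
  qed
  {
    case 0
    show ?case using one[of 0 0] C(1) by (simp add: power2_eq_square)
  next
    case (Suc N)
    have intS: "integrable M (\<lambda>x. (\<Sum>i\<le>N. \<psi> i x)\<^sup>2)"
      unfolding power2_eq_square sum_product by (intro Bochner_Integration.integrable_sum int)
    have intc: "integrable M (\<lambda>x. \<Sum>i\<le>N. \<psi> i x * \<psi> (Suc N) x)"
      by (intro Bochner_Integration.integrable_sum int)
    have "(\<Sum>i\<le>Suc N. \<psi> i x)\<^sup>2 = (\<Sum>i\<le>N. \<psi> i x)\<^sup>2 + 2 * (\<Sum>i\<le>N. \<psi> i x * \<psi> (Suc N) x)
        + \<psi> (Suc N) x * \<psi> (Suc N) x" for x
      by (simp add: power2_eq_square algebra_simps sum_distrib_left)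
    then have "(\<integral>x. (\<Sum>i\<le>Suc N. \<psi> i x)\<^sup>2 \<partial>M) = (\<integral>x. (\<Sum>i\<le>N. \<psi> i x)\<^sup>2 \<partial>M)
        + 2 * (\<Sum>i\<le>N. \<integral>x. \<psi> i x * \<psi> (Suc N) x \<partial>M) + (\<integral>x. \<psi> (Suc N) x * \<psi> (Suc N) x \<partial>M)"
      using intS intc int by simp
    moreover have "(\<Sum>i\<le>N. \<integral>x. \<psi> i x * \<psi> (Suc N) x \<partial>M) \<le> 2 * C + 1"
    proof -
      have "(\<Sum>i\<le>N. \<integral>x. \<psi> i x * \<psi> (Suc N) x \<partial>M)
          = (\<Sum>i<N. \<integral>x. \<psi> i x * \<psi> (Suc N) x \<partial>M) + (\<integral>x. \<psi> N x * \<psi> (Suc N) x \<partial>M)"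
        by (simp add: lessThan_Suc_atMost[symmetric])
      also have "(\<Sum>i<N. \<integral>x. \<psi> i x * \<psi> (Suc N) x \<partial>M) \<le> (\<Sum>i<N. C * (1 / (real (i + 1))\<^sup>2))"
        using C(2) by (intro sum_mono) (force simp: abs_le_iff)
      also have "\<dots> \<le> C * 2"
        unfolding sum_distrib_left[symmetric] by (intro mult_left_mono sum_inverse_squares_le C)
      finally show ?thesis using one[of N "Suc N"] by linarith
    qed
    \<comment> \<open>The increment is at most \<open>2 * (2 * C + 1) + 1\<close>.\<close>
    ultimately show ?case using Suc one[of "Suc N" "Suc N"] by (simp add: algebra_simps)
  }
qed

text \<open>Between \<open>k\<^sup>2\<close> and \<open>(k + 1)\<^sup>2\<close> the sum changes by at most \<open>2 k\<close>, which is negligible compared with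
  \<open>k\<^sup>2\<close>.\<close>

lemma average_from_squares:
  fixes s :: "nat \<Rightarrow> real"
  assumes step: "\<And>n. \<bar>s (Suc n) - s n\<bar> \<le> 1"
    and sq: "(\<lambda>k. s (k\<^sup>2) / (real k)\<^sup>2) \<longlonglongrightarrow> 0"
  shows "(\<lambda>n. s n / real n) \<longlonglongrightarrow> 0"
proof -
  \<comment> \<open>\<open>(r n)\<^sup>2\<close> is the last square up to \<open>n\<close>.\<close>
  define r where "r = (\<lambda>n. nat \<lfloor>sqrt (real n)\<rfloor>)"
  have r: "(r n)\<^sup>2 \<le> n" "n \<le> (r n)\<^sup>2 + 2 * r n" for n
  proof -
    have fl: "real (r n) \<le> sqrt (real n)" "sqrt (real n) < real (r n) + 1"
      by (simp_all add: r_def)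
    have "(real (r n))\<^sup>2 \<le> (sqrt (real n))\<^sup>2" using fl by (intro power_mono) auto
    then have "real ((r n)\<^sup>2) \<le> real n" by simp
    then show "(r n)\<^sup>2 \<le> n" by (simp only: of_nat_le_iff)
    have "(sqrt (real n))\<^sup>2 < (real (r n) + 1)\<^sup>2" using fl by (intro power_strict_mono) auto
    then have "real n < real ((r n + 1)\<^sup>2)" by (simp add: add.commute)
    then have "n < (r n + 1)\<^sup>2" by (simp only: of_nat_less_iff)
    then show "n \<le> (r n)\<^sup>2 + 2 * r n" by (simp add: power2_eq_square)
  qed
  have rlim: "filterlim r sequentially sequentially"
    unfolding filterlim_at_top
  proof
    fix Z
    show "\<forall>\<^sub>F n in sequentially. Z \<le> r n"
      using eventually_ge_at_top[of "Z\<^sup>2"]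
    proof eventually_elim
      case (elim n)
      then have "real Z \<le> sqrt (real n)"
        by (intro real_le_rsqrt) (simp only: of_nat_power[symmetric] of_nat_le_iff)
      then show ?case unfolding r_def by (rule le_nat_floor)
    qed
  qed
  have var: "\<bar>s (m + d) - s m\<bar> \<le> real d" for m d
  proof (induction d)
    case (Suc d)
    then show ?case using step[of "m + d"] by simp
  qed simp
  have "\<forall>\<^sub>F n in sequentially. norm (s n / real n) \<le> \<bar>s ((r n)\<^sup>2) / (real (r n))\<^sup>2\<bar> + 2 / real (r n)"
    using rlim[unfolded filterlim_at_top, rule_format, of 1]
  proof eventually_elim
    case (elim n)
    define k where "k = r n"
    have k: "1 \<le> k" "k\<^sup>2 \<le> n" "n \<le> k\<^sup>2 + 2 * k" using elim r[of n] by (auto simp: k_def)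
    have n: "real (k\<^sup>2) \<le> real n" "0 < real (k\<^sup>2)" using k by (auto simp del: of_nat_power)
    have "\<bar>s n - s (k\<^sup>2)\<bar> \<le> real (n - k\<^sup>2)" using var[of "k\<^sup>2" "n - k\<^sup>2"] k by simp
    also have "\<dots> \<le> real (2 * k)" using k by (intro of_nat_mono) simp
    finally have "\<bar>s n\<bar> \<le> \<bar>s (k\<^sup>2)\<bar> + 2 * real k" by simp
    then have "\<bar>s n\<bar> / real n \<le> (\<bar>s (k\<^sup>2)\<bar> + 2 * real k) / real (k\<^sup>2)"
      using n by (intro frac_le) auto
    also have "\<dots> = \<bar>s (k\<^sup>2) / (real k)\<^sup>2\<bar> + 2 * real k / (real k)\<^sup>2"
      by (simp add: add_divide_distrib)
    also have "2 * real k / (real k)\<^sup>2 = 2 / real k"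
      using k by (simp add: power2_eq_square)
    finally show ?case by (simp add: k_def)
  qed
  then show ?thesis
  proof (rule Lim_null_comparison)
    have "(\<lambda>n. \<bar>s ((r n)\<^sup>2) / (real (r n))\<^sup>2\<bar>) \<longlonglongrightarrow> 0"
      by (rule filterlim_compose[OF tendsto_rabs_zero[OF sq] rlim])
    moreover have "(\<lambda>n. 2 / real (r n)) \<longlonglongrightarrow> 0"
      by (rule filterlim_compose[OF lim_const_over_n rlim])
    ultimately show "(\<lambda>n. \<bar>s ((r n)\<^sup>2) / (real (r n))\<^sup>2\<bar> + 2 / real (r n)) \<longlonglongrightarrow> 0"
      by (rule tendsto_add_zero)
  qed
qed

text \<open>Along \<open>N = k\<^sup>2\<close> the second moments of the averages are of order \<open>1 / k\<^sup>2\<close>, hence summable. So the squares of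
  the averages are almost everywhere summable and tend to \<open>0\<close>.\<close>

lemma AE_average_of_second_moment:
  fixes \<psi> :: "nat \<Rightarrow> 'a \<Rightarrow> real"
  assumes fin: "finite_measure M"
    and meas [measurable]: "\<And>i. \<psi> i \<in> borel_measurable M" and b: "\<And>i x. \<bar>\<psi> i x\<bar> \<le> 1"
    and K: "\<And>N. (\<integral>x. (\<Sum>i\<le>N. \<psi> i x)\<^sup>2 \<partial>M) \<le> K * real (N + 1)"
  shows "AE x in M. (\<lambda>N. (\<Sum>i\<le>N. \<psi> i x) / real N) \<longlonglongrightarrow> 0"
proof -
  define S where "S = (\<lambda>N x. \<Sum>i\<le>N. \<psi> i x)"
  define g where "g = (\<lambda>k x. (S ((Suc k)\<^sup>2) x / (real (Suc k))\<^sup>2)\<^sup>2)"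
  have [measurable]: "S N \<in> borel_measurable M" for N unfolding S_def by measurable
  have [measurable]: "g k \<in> borel_measurable M" for k unfolding g_def by measurable
  have K0: "0 \<le> K"
  proof -
    have "0 \<le> (\<integral>x. (\<Sum>i\<le>0. \<psi> i x)\<^sup>2 \<partial>M)" by (rule Bochner_Integration.integral_nonneg) simp
    from order.trans[OF this K[of 0]] show ?thesis by simp
  qed
  have intS: "integrable M (\<lambda>x. (S N x)\<^sup>2)" for N
  proof (rule finite_measure.integrable_const_bound[OF fin, of _ "(real (N + 1))\<^sup>2"])
    have "\<bar>S N x\<bar> \<le> (\<Sum>i\<le>N. 1)" for x
      unfolding S_def by (rule order.trans[OF sum_abs sum_mono]) (rule b)
    then have "\<bar>S N x\<bar> \<le> real (N + 1)" for x by simp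
    then have "\<bar>S N x\<bar>\<^sup>2 \<le> (real (N + 1))\<^sup>2" for x by (intro power_mono) auto
    then show "AE x in M. norm ((S N x)\<^sup>2) \<le> (real (N + 1))\<^sup>2" by simp
  qed measurable
  have gint: "(\<integral>\<^sup>+x. ennreal (g k x) \<partial>M) \<le> ennreal (2 * K * inverse ((real (Suc k))\<^sup>2))" for k
  proof -
    define m where "m = (real (Suc k))\<^sup>2"
    have m: "1 \<le> m" by (simp add: m_def)
    have g: "g k x = (S ((Suc k)\<^sup>2) x)\<^sup>2 / m\<^sup>2" for x by (simp add: g_def m_def power_divide)
    have "(\<integral>\<^sup>+x. ennreal (g k x) \<partial>M) = ennreal (\<integral>x. g k x \<partial>M)"
      unfolding g by (intro nn_integral_eq_integral integrable_divide intS) auto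
    also have "(\<integral>x. g k x \<partial>M) = (\<integral>x. (S ((Suc k)\<^sup>2) x)\<^sup>2 \<partial>M) / m\<^sup>2"
      unfolding g by simp
    also have "\<dots> \<le> K * (m + 1) / m\<^sup>2"
      using K[of "(Suc k)\<^sup>2"] by (intro divide_right_mono) (simp_all add: S_def m_def add.commute)
    also have "\<dots> \<le> K * (2 * m) / m\<^sup>2"
      using m K0 by (intro divide_right_mono mult_left_mono) auto
    also have "\<dots> = 2 * K * inverse m"
      using m by (simp add: power2_eq_square field_simps)
    finally show ?thesis by (simp add: m_def ennreal_leI)
  qed
  have "(\<integral>\<^sup>+x. (\<Sum>k. ennreal (g k x)) \<partial>M) = (\<Sum>k. \<integral>\<^sup>+x. ennreal (g k x) \<partial>M)"
    by (rule nn_integral_suminf) measurable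
  also have "\<dots> \<le> (\<Sum>k. ennreal (2 * K * inverse ((real (Suc k))\<^sup>2)))"
    by (intro suminf_le gint) auto
  also have "\<dots> < top"
    unfolding less_top[symmetric]
  proof (rule ennreal_suminf_neq_top)
    have "summable (\<lambda>k. inverse ((real (Suc k))\<^sup>2))"
      using inverse_power_summable[of 2, where 'a = real] by (subst summable_Suc_iff) auto
    then show "summable (\<lambda>k. 2 * K * inverse ((real (Suc k))\<^sup>2))"
      by (rule summable_mult)
  qed (use K0 in auto)
  finally have "(\<integral>\<^sup>+x. (\<Sum>k. ennreal (g k x)) \<partial>M) \<noteq> \<infinity>" by simp
  then have "AE x in M. (\<Sum>k. ennreal (g k x)) \<noteq> \<infinity>"
    by (intro nn_integral_PInf_AE) measurable
  then show ?thesis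
  proof eventually_elim
    case (elim x)
    then have "summable (\<lambda>k. g k x)"
      by (intro summable_suminf_not_top) (auto simp: g_def)
    then have "(\<lambda>k. g k x) \<longlonglongrightarrow> 0" by (rule summable_LIMSEQ_zero)
    then have "(\<lambda>k. sqrt (g k x)) \<longlonglongrightarrow> sqrt 0" by (rule tendsto_real_sqrt)
    then have "(\<lambda>k. \<bar>S ((Suc k)\<^sup>2) x / (real (Suc k))\<^sup>2\<bar>) \<longlonglongrightarrow> 0" by (simp add: g_def)
    then have "(\<lambda>k. S ((Suc k)\<^sup>2) x / (real (Suc k))\<^sup>2) \<longlonglongrightarrow> 0" by (rule tendsto_rabs_zero_cancel)
    then have "(\<lambda>k. S (k\<^sup>2) x / (real k)\<^sup>2) \<longlonglongrightarrow> 0" by (rule LIMSEQ_imp_Suc)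
    then have "(\<lambda>n. S n x / real n) \<longlonglongrightarrow> 0"
      by (intro average_from_squares) (auto simp: S_def b)
    then show ?case by (simp add: S_def)
  qed
qed

lemma AE_birkhoff_avg_wave:
  fixes a b :: int and K0 K1 \<theta> :: real and w :: "nat \<Rightarrow> real"
  assumes adm: "\<And>k. 1 \<le> k \<Longrightarrow> admissible K0 K1 M0 (w k ^ 4) (f k)"
    and K: "0 < K0" "0 < K1"
    and mono: "mono_on {1..} w"
    and big: "\<forall>\<^sub>F k in sequentially. real k ^ 3 \<le> w k"
    and ab: "(a, b) \<noteq> (0, 0)"
  shows "AE p in Leb_T2. (\<lambda>N. birkhoff_avg f (wave a b \<theta>) N p) \<longlonglongrightarrow> 0"
proof -
  obtain C where C: "0 \<le> C" "\<And>i j. i + 2 \<le> j \<Longrightarrow>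
    \<bar>\<integral>p. wave a b \<theta> (comp_map f i p) * wave a b \<theta> (comp_map f j p) \<partial>Leb_T2\<bar> \<le> C / (real (i + 1))\<^sup>2"
    using wave_correlation_decay[OF adm K mono big ab, of \<theta>] by blast
  have fm: "f k \<in> borel_measurable borel" if "1 \<le> k" for k
    by (rule borel_measurable_continuous_onI[OF admissible_continuous(1)[OF adm[OF that]]])
  have wm: "wave a b \<theta> \<in> borel_measurable Leb_T2"
    by (rule measurable_Leb_T2[OF borel_measurable_continuous_onI[OF continuous_wave]])
  have m: "(\<lambda>p. wave a b \<theta> (comp_map f i p)) \<in> borel_measurable Leb_T2" for i
    by (rule measurable_compose[OF measurable_comp_map[of f, OF fm] wm])
  have "AE p in Leb_T2. (\<lambda>N. (\<Sum>i\<le>N. wave a b \<theta> (comp_map f i p)) / real N) \<longlonglongrightarrow> 0"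
    by (rule AE_average_of_second_moment[OF finite_measure_Leb_T2 m abs_wave_le
          second_moment_of_decaying_correlations[OF _ m abs_wave_le C]])
       (simp add: emeasure_Leb_T2)
  then show ?thesis
    by (simp add: birkhoff_avg_def[abs_def] atMost_atLeast0)
qed

section \<open>Approximation by trigonometric polynomials\<close>

inductive trig_poly :: "(real \<times> real \<Rightarrow> real) \<Rightarrow> bool" where
  wave: "trig_poly (wave a b \<theta>)"
| scale: "trig_poly f \<Longrightarrow> trig_poly (\<lambda>p. c * f p)"
| add: "trig_poly f \<Longrightarrow> trig_poly g \<Longrightarrow> trig_poly (\<lambda>p. f p + g p)"

lemma trig_poly_const: "trig_poly (\<lambda>p. c)"
proof -
  have "trig_poly (\<lambda>p. c * wave 0 0 0 p)" by (intro trig_poly.intros)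
  then show ?thesis by (simp add: wave_def)
qed

lemma wave_times_wave:
  "wave a b \<theta> p * wave a' b' \<theta>' p
    = 1 / 2 * wave (a - a') (b - b') (\<theta> - \<theta>') p + 1 / 2 * wave (a + a') (b + b') (\<theta> + \<theta>') p"
  unfolding wave_def cos_times_cos by (simp add: algebra_simps add_divide_distrib)

lemma trig_poly_mult:
  assumes "trig_poly f" "trig_poly g"
  shows "trig_poly (\<lambda>p. f p * g p)"
  using assms
proof (induction arbitrary: g)
  case (wave a b \<theta>)
  then show ?case
  proof (induction g)
    case (wave a' b' \<theta>')
    show ?case unfolding wave_times_wave by (intro trig_poly.intros)
  next
    case (scale g c)
    from trig_poly.scale[OF scale.IH, of c] show ?case by (simp add: mult_ac)
  next
    case (add g h)
    from trig_poly.add[OF add.IH] show ?case by (simp add: algebra_simps)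
  qed
next
  case (scale f c)
  from trig_poly.scale[OF scale.IH[OF scale.prems], of c] show ?case by (simp add: mult_ac)
next
  case (add f h)
  from trig_poly.add[OF add.IH(1)[OF add.prems] add.IH(2)[OF add.prems]]
  show ?case by (simp add: algebra_simps)
qed

definition torus_emb :: "real \<times> real \<Rightarrow> complex \<times> complex" where
  "torus_emb p = (cis (2 * pi * fst p), cis (2 * pi * snd p))"

text \<open>Polynomials in the coordinates of the embedded torus are trigonometric polynomials, since the coordinates
  are \<open>cos\<close> and \<open>sin\<close> of the angles and products of cosines are sums of cosines.\<close>

lemma trig_poly_of_real_polynomial:
  assumes "real_polynomial_function g"
  shows "trig_poly (\<lambda>p. g (torus_emb p))"
  using assms
proof induction
  case (linear h)
  interpret bounded_linear h by fact
  have "h (torus_emb p) = wave 1 0 0 p * h (1, 0) + wave 1 0 (- (pi / 2)) p * h (\<i>, 0)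
      + wave 0 1 0 p * h (0, 1) + wave 0 1 (- (pi / 2)) p * h (0, \<i>)" for p
  proof -
    have "torus_emb p = cos (2 * pi * fst p) *\<^sub>R (1, 0) + sin (2 * pi * fst p) *\<^sub>R (\<i>, 0)
        + cos (2 * pi * snd p) *\<^sub>R (0, 1) + sin (2 * pi * snd p) *\<^sub>R (0, \<i>)"
      by (simp add: torus_emb_def complex_eq_iff)
    then have "h (torus_emb p) = cos (2 * pi * fst p) * h (1, 0) + sin (2 * pi * fst p) * h (\<i>, 0)
        + cos (2 * pi * snd p) * h (0, 1) + sin (2 * pi * snd p) * h (0, \<i>)"
      by (simp only: add scaleR real_scaleR_def)
    then show ?thesis
      by (simp add: wave_def cos_diff)
  qed
  then show ?case
    by (simp only:) (intro trig_poly.add trig_poly_mult trig_poly.wave trig_poly_const)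
next
  case (const c)
  show ?case by (rule trig_poly_const)
next
  case (add f g)
  then show ?case by (intro trig_poly.add)
next
  case (mult f g)
  then show ?case by (intro trig_poly_mult)
qed

definition periodic2 :: "(real \<times> real \<Rightarrow> real) \<Rightarrow> bool" where
  "periodic2 \<phi> \<longleftrightarrow> (\<forall>x y. \<forall>k l::int. \<phi> (x + of_int k, y + of_int l) = \<phi> (x, y))"

lemma cis_2pi_eqD:
  assumes "cis (2 * pi * x) = cis (2 * pi * y)"
  obtains k :: int where "x = y + of_int k"
proof -
  have "sin (2 * pi * x) = sin (2 * pi * y) \<and> cos (2 * pi * x) = cos (2 * pi * y)"
    using assms by (simp add: complex_eq_iff)
  then obtain k :: int where "2 * pi * x = 2 * pi * y + 2 * pi * of_int k"
    using sin_cos_eq_iff by blast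
  then have "2 * pi * x = 2 * pi * (y + of_int k)" by (simp add: algebra_simps)
  then have "x = y + of_int k" by simp
  then show ?thesis by (rule that)
qed

text \<open>A periodic function descends to the embedded torus, which carries the quotient topology of the closed unit
  square: preimages of closed sets are images of compact sets. There the Stone--Weierstrass theorem applies.\<close>

lemma trig_poly_approximation:
  fixes \<phi> :: "real \<times> real \<Rightarrow> real"
  assumes cont: "continuous_on UNIV \<phi>" and per: "periodic2 \<phi>" and e: "0 < e"
  obtains T where "trig_poly T" "\<And>p. p \<in> T2 \<Longrightarrow> \<bar>\<phi> p - T p\<bar> < e"
proof -
  define Q where "Q = {0..1::real} \<times> {0..1::real}"
  have Q: "compact Q" by (simp add: Q_def compact_Times)
  have cemb: "continuous_on A torus_emb" for A
    unfolding torus_emb_def[abs_def] by (intro continuous_intros continuous_on_cis)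
  define S where "S = torus_emb ` Q"
  define \<Phi> where "\<Phi> = (\<lambda>z. \<phi> (SOME p. p \<in> Q \<and> torus_emb p = z))"
  have \<phi>_eq: "\<phi> p = \<phi> q" if "torus_emb p = torus_emb q" for p q
  proof -
    obtain x y u v where pq: "p = (x, y)" "q = (u, v)" by (cases p, cases q)
    have "cis (2 * pi * x) = cis (2 * pi * u)" "cis (2 * pi * y) = cis (2 * pi * v)"
      using that by (simp_all add: pq torus_emb_def)
    then obtain k l where "x = u + of_int k" "y = v + of_int l"
      by (elim cis_2pi_eqD)
    then show ?thesis using per by (simp add: pq periodic2_def)
  qed
  have \<Phi>: "\<Phi> (torus_emb p) = \<phi> p" if "p \<in> Q" for p
    unfolding \<Phi>_def
    by (rule \<phi>_eq) (use someI[of "\<lambda>q. q \<in> Q \<and> torus_emb q = torus_emb p" p] that in blast)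
  have S: "compact S" unfolding S_def by (rule compact_continuous_image[OF cemb Q])
  have "continuous_on S \<Phi>"
    unfolding continuous_on_closed_vimage[OF compact_imp_closed[OF S]]
  proof (intro allI impI)
    fix B :: "real set" assume "closed B"
    have "\<Phi> -` B \<inter> S = torus_emb ` (Q \<inter> \<phi> -` B)"
      using \<Phi> by (auto simp: S_def)
    moreover have "compact (Q \<inter> \<phi> -` B)"
      by (intro compact_Int_closed Q closed_vimage \<open>closed B\<close> cont)
    ultimately show "closed (\<Phi> -` B \<inter> S)"
      using compact_imp_closed[OF compact_continuous_image[OF cemb]] by simp
  qed
  from Stone_Weierstrass_real_polynomial_function[OF S this e]
  obtain g where g: "real_polynomial_function g" "\<And>z. z \<in> S \<Longrightarrow> \<bar>\<Phi> z - g z\<bar> < e" by blast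
  show ?thesis
  proof (rule that[OF trig_poly_of_real_polynomial[OF g(1)]])
    fix p assume "p \<in> T2"
    then have "p \<in> Q" by (auto simp: Q_def T2_def T1_def)
    then show "\<bar>\<phi> p - g (torus_emb p)\<bar> < e" using g(2)[of "torus_emb p"] by (simp add: \<Phi> S_def)
  qed
qed

lemma Holder_T2D:
  assumes H: "Holder_T2 \<alpha> \<phi>" and \<alpha>: "0 < \<alpha>"
  shows "continuous_on UNIV \<phi>" and "periodic2 \<phi>"
proof -
  obtain C where C: "\<And>p q. \<bar>\<phi> p - \<phi> q\<bar> \<le> C * dist_T2 p q powr \<alpha>"
    using H by (auto simp: Holder_T2_def)
  show "periodic2 \<phi>"
    unfolding periodic2_def
  proof (intro allI)
    fix x y and k l :: int
    have "dist_T2 (x + of_int k, y + of_int l) (x, y) = 0"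
      unfolding dist_T2_def by (rule infdist_zero) force
    then show "\<phi> (x + of_int k, y + of_int l) = \<phi> (x, y)"
      using C[of "(x + of_int k, y + of_int l)" "(x, y)"] by simp
  qed
  show "continuous_on UNIV \<phi>"
  proof (rule continuous_at_imp_continuous_on, rule ballI)
    fix q
    have le: "dist_T2 p q \<le> dist p q" for p
      unfolding dist_T2_def by (rule infdist_le) (force simp: zero_prod_def[symmetric] intro!: image_eqI[of _ _ "(0, 0)"])
    have nn: "0 \<le> dist_T2 p q" for p unfolding dist_T2_def by (rule infdist_nonneg)
    have "(\<lambda>p. \<phi> p - \<phi> q) \<midarrow>q\<rightarrow> 0"
    proof (rule Lim_null_comparison)
      show "\<forall>\<^sub>F p in at q. norm (\<phi> p - \<phi> q) \<le> \<bar>C\<bar> * dist p q powr \<alpha>"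
      proof (rule always_eventually, rule allI)
        fix p
        have "\<bar>\<phi> p - \<phi> q\<bar> \<le> C * dist_T2 p q powr \<alpha>" by (rule C)
        also have "\<dots> \<le> \<bar>C\<bar> * dist p q powr \<alpha>"
          using le nn \<alpha> by (intro mult_mono powr_mono2) auto
        finally show "norm (\<phi> p - \<phi> q) \<le> \<bar>C\<bar> * dist p q powr \<alpha>" by simp
      qed
      have "((\<lambda>p. dist p q powr \<alpha>) \<longlongrightarrow> 0) (at q)"
        by (rule tendsto_zero_powrI) (use \<alpha> in \<open>auto intro!: tendsto_eq_intros simp: always_eventually\<close>)
      then show "((\<lambda>p. \<bar>C\<bar> * dist p q powr \<alpha>) \<longlongrightarrow> 0) (at q)"
        by (rule tendsto_mult_right_zero)
    qed
    then show "isCont \<phi> q" unfolding isCont_def by (rule LIM_zero_cancel)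
  qed
qed

lemma periodic2_bounded:
  assumes "continuous_on UNIV \<phi>" "periodic2 \<phi>"
  obtains b where "\<And>p. \<bar>\<phi> p\<bar> \<le> b"
proof -
  have "bounded (\<phi> ` ({0..1} \<times> {0..1}))"
    by (intro compact_imp_bounded compact_continuous_image compact_Times)
       (auto intro: continuous_on_subset[OF assms(1)])
  then obtain b where b: "\<forall>z\<in>\<phi> ` ({0..1} \<times> {0..1}). norm z \<le> b" unfolding bounded_iff by blast
  have "\<bar>\<phi> p\<bar> \<le> b" for p
  proof -
    obtain x y where p: "p = (x, y)" by (cases p)
    have "\<phi> (frac x, frac y) = \<phi> (frac x + of_int \<lfloor>x\<rfloor>, frac y + of_int \<lfloor>y\<rfloor>)"
      using assms(2) by (simp add: periodic2_def)
    then have "\<phi> p = \<phi> (frac x, frac y)" by (simp add: p frac_def)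
    moreover have "\<bar>\<phi> (frac x, frac y)\<bar> \<le> b"
      using b frac_lt_1[of x] frac_lt_1[of y] by (auto simp: less_imp_le)
    ultimately show ?thesis by simp
  qed
  then show ?thesis by (rule that)
qed

lemma trig_poly_bounded_continuous:
  assumes "trig_poly T"
  shows "continuous_on UNIV T \<and> (\<exists>b. \<forall>p. \<bar>T p\<bar> \<le> b)"
  using assms
proof induction
  case (wave a b \<theta>)
  show ?case using continuous_wave abs_wave_le by blast
next
  case (scale f c)
  then obtain b where b: "\<And>p. \<bar>f p\<bar> \<le> b" by blast
  have "\<bar>c * f p\<bar> \<le> \<bar>c\<bar> * b" for p unfolding abs_mult by (intro mult_left_mono b) auto
  then show ?case using scale by (auto intro!: continuous_intros)
next
  case (add f g)
  then obtain b b' where b: "\<And>p. \<bar>f p\<bar> \<le> b" "\<And>p. \<bar>g p\<bar> \<le> b'" by blast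
  have "\<bar>f p + g p\<bar> \<le> b + b'" for p
    using b[of p] abs_triangle_ineq[of "f p" "g p"] by linarith
  then show ?case using add by (auto intro!: continuous_intros)
qed

section \<open>Birkhoff averages of continuous observables\<close>

lemma birkhoff_avg_add:
  "birkhoff_avg f (\<lambda>p. \<phi> p + \<psi> p) N p = birkhoff_avg f \<phi> N p + birkhoff_avg f \<psi> N p"
  by (simp add: birkhoff_avg_def sum.distrib algebra_simps add_divide_distrib)

lemma birkhoff_avg_scale:
  "birkhoff_avg f (\<lambda>p. c * \<phi> p) N p = c * birkhoff_avg f \<phi> N p"
  by (simp add: birkhoff_avg_def sum_distrib_left)

lemma birkhoff_avg_const:
  "(\<lambda>N. birkhoff_avg f (\<lambda>p. c) N p) \<longlonglongrightarrow> c"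
proof -
  have "(\<lambda>N. c * (real (Suc N) / real N)) \<longlonglongrightarrow> c * 1"
    by (intro tendsto_mult tendsto_const LIMSEQ_Suc_n_over_n)
  then show ?thesis by (simp add: birkhoff_avg_def mult.commute)
qed

lemma abs_birkhoff_avg_le:
  assumes "\<And>p. p \<in> T2 \<Longrightarrow> \<bar>\<phi> p\<bar> \<le> b" "p \<in> T2"
  shows "\<bar>birkhoff_avg f \<phi> N p\<bar> \<le> 2 * b"
proof -
  have b: "0 \<le> b" using assms(1)[OF assms(2)] by linarith
  have "\<bar>\<Sum>i=0..N. \<phi> (comp_map f i p)\<bar> \<le> (\<Sum>i=0..N. b)"
    by (rule order.trans[OF sum_abs sum_mono]) (intro assms(1) comp_map_in_T2 assms(2))
  then have "\<bar>birkhoff_avg f \<phi> N p\<bar> \<le> (real (N + 1) * b) / real N"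
    by (simp add: birkhoff_avg_def abs_mult divide_right_mono)
  also have "\<dots> \<le> 2 * b"
    using mult_right_mono[of 1 "real N" b] b by (cases "N = 0") (simp_all add: field_simps)
  finally show ?thesis .
qed

context
  fixes f :: "nat \<Rightarrow> real \<Rightarrow> real"
  assumes fm: "\<And>k. 1 \<le> k \<Longrightarrow> f k \<in> borel_measurable borel"
begin

lemma measurable_birkhoff_avg:
  assumes "\<phi> \<in> borel_measurable Leb_T2"
  shows "birkhoff_avg f \<phi> N \<in> borel_measurable Leb_T2"
  unfolding birkhoff_avg_def[abs_def]
  by (intro borel_measurable_times borel_measurable_const borel_measurable_sum
      measurable_compose[OF measurable_comp_map[of f, OF fm] assms])

text \<open>By invariance the integral of the average is \<open>(N + 1) / N\<close> times that of the observable. This identifies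
  the limit without computing any integral of a character.\<close>

lemma birkhoff_limit_eq_integral:
  assumes m: "\<phi> \<in> borel_measurable Leb_T2" and b: "\<And>p. p \<in> T2 \<Longrightarrow> \<bar>\<phi> p\<bar> \<le> b"
    and lim: "AE p in Leb_T2. (\<lambda>N. birkhoff_avg f \<phi> N p) \<longlonglongrightarrow> c"
  shows "c = (\<integral>p. \<phi> p \<partial>Leb_T2)"
proof -
  have int: "integrable Leb_T2 (\<lambda>p. \<phi> (comp_map f i p))" for i
    by (intro integrable_Leb_T2[where b = b] b comp_map_in_T2
        measurable_compose[OF measurable_comp_map[of f, OF fm] m])
  \<comment> \<open>The integral is itself an average of a constant observable, for which the base point is arbitrary.\<close>
  have "(\<integral>p. birkhoff_avg f \<phi> N p \<partial>Leb_T2) = birkhoff_avg f (\<lambda>_. \<integral>p. \<phi> p \<partial>Leb_T2) N undefined" for N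
    unfolding birkhoff_avg_def using int integral_comp_map[of f, OF fm m] by simp
  then have "(\<lambda>N. \<integral>p. birkhoff_avg f \<phi> N p \<partial>Leb_T2) \<longlonglongrightarrow> (\<integral>p. \<phi> p \<partial>Leb_T2)"
    by (simp only: birkhoff_avg_const)
  moreover have "(\<lambda>N. \<integral>p. birkhoff_avg f \<phi> N p \<partial>Leb_T2) \<longlonglongrightarrow> (\<integral>p. c \<partial>Leb_T2)"
  proof (rule integral_dominated_convergence[where w = "\<lambda>_. 2 * b"])
    show "integrable Leb_T2 (\<lambda>_. 2 * b)"
      by (rule finite_measure.integrable_const[OF finite_measure_Leb_T2])
    show "AE p in Leb_T2. norm (birkhoff_avg f \<phi> N p) \<le> 2 * b" for N
      using abs_birkhoff_avg_le[OF b] by (intro AE_I2) simp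
  qed (auto intro!: measurable_birkhoff_avg m lim)
  moreover have "(\<integral>p. c \<partial>Leb_T2) = c" by (simp add: measure_Leb_T2)
  ultimately show ?thesis using LIMSEQ_unique by metis
qed

lemma trig_poly_birkhoff_avg:
  assumes waves: "\<And>a b \<theta>. (a, b) \<noteq> (0, 0) \<Longrightarrow>
      AE p in Leb_T2. (\<lambda>N. birkhoff_avg f (wave a b \<theta>) N p) \<longlonglongrightarrow> 0"
    and T: "trig_poly T"
  shows "\<exists>c. AE p in Leb_T2. (\<lambda>N. birkhoff_avg f T N p) \<longlonglongrightarrow> c"
  using T
proof induction
  case (wave a b \<theta>)
  show ?case
  proof (cases "(a, b) = (0, 0)")
    case True
    then have "wave a b \<theta> = (\<lambda>p. cos \<theta>)" by (auto simp: wave_def)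
    then show ?thesis by (intro exI[of _ "cos \<theta>"] AE_I2) (simp only: birkhoff_avg_const)
  qed (use waves in blast)
next
  case (scale g c)
  then obtain l where "AE p in Leb_T2. (\<lambda>N. birkhoff_avg f g N p) \<longlonglongrightarrow> l" by blast
  then have "AE p in Leb_T2. (\<lambda>N. birkhoff_avg f (\<lambda>p. c * g p) N p) \<longlonglongrightarrow> c * l"
    unfolding birkhoff_avg_scale by eventually_elim (intro tendsto_intros)
  then show ?case by blast
next
  case (add g h)
  then obtain l l' where "AE p in Leb_T2. (\<lambda>N. birkhoff_avg f g N p) \<longlonglongrightarrow> l"
    "AE p in Leb_T2. (\<lambda>N. birkhoff_avg f h N p) \<longlonglongrightarrow> l'" by blast
  then have "AE p in Leb_T2. (\<lambda>N. birkhoff_avg f (\<lambda>p. g p + h p) N p) \<longlonglongrightarrow> l + l'"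
    unfolding birkhoff_avg_add by eventually_elim (intro tendsto_intros)
  then show ?case by blast
qed

text \<open>If \<open>T\<close> is uniformly \<open>e\<close>-close to \<open>\<phi>\<close>, then the limit of the averages of \<open>T\<close> is its mean, which is at
  most \<open>e\<close>, and the averages of \<open>\<phi> - T\<close> are at most \<open>2 e\<close>.\<close>

lemma AE_birkhoff_avg:
  assumes waves: "\<And>a b \<theta>. (a, b) \<noteq> (0, 0) \<Longrightarrow>
      AE p in Leb_T2. (\<lambda>N. birkhoff_avg f (wave a b \<theta>) N p) \<longlonglongrightarrow> 0"
    and cont: "continuous_on UNIV \<phi>" and per: "periodic2 \<phi>" and mean: "(\<integral>p. \<phi> p \<partial>Leb_T2) = 0"
  shows "AE p in Leb_T2. (\<lambda>N. birkhoff_avg f \<phi> N p) \<longlonglongrightarrow> 0"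
proof -
  have near: "AE p in Leb_T2. \<forall>\<^sub>F N in sequentially. \<bar>birkhoff_avg f \<phi> N p\<bar> < 4 * e" if e: "0 < e" for e
  proof -
    obtain T where T: "trig_poly T" "\<And>p. p \<in> T2 \<Longrightarrow> \<bar>\<phi> p - T p\<bar> < e"
      using trig_poly_approximation[OF cont per e] by blast
    obtain c where c: "AE p in Leb_T2. (\<lambda>N. birkhoff_avg f T N p) \<longlonglongrightarrow> c"
      using trig_poly_birkhoff_avg[OF waves T(1)] by blast
    obtain b where b: "\<And>p. \<bar>T p\<bar> \<le> b" and cT: "continuous_on UNIV T"
      using trig_poly_bounded_continuous[OF T(1)] by blast
    obtain b' where b': "\<And>p. \<bar>\<phi> p\<bar> \<le> b'" using periodic2_bounded[OF cont per] by blast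
    have mT: "T \<in> borel_measurable Leb_T2" and m\<phi>: "\<phi> \<in> borel_measurable Leb_T2"
      using cT cont by (auto intro: measurable_Leb_T2 borel_measurable_continuous_onI)
    have iT: "integrable Leb_T2 T" and i\<phi>: "integrable Leb_T2 \<phi>"
      using integrable_Leb_T2[OF mT b] integrable_Leb_T2[OF m\<phi> b'] by auto
    have "c = (\<integral>p. T p \<partial>Leb_T2)"
      by (rule birkhoff_limit_eq_integral[OF mT b c])
    also have "\<dots> = (\<integral>p. T p - \<phi> p \<partial>Leb_T2)"
      using iT i\<phi> mean by simp
    finally have "\<bar>c\<bar> \<le> (\<integral>p. \<bar>T p - \<phi> p\<bar> \<partial>Leb_T2)" by simp
    also have "\<dots> \<le> (\<integral>p. e \<partial>Leb_T2)"
    proof (rule integral_mono)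
      show "integrable Leb_T2 (\<lambda>p. \<bar>T p - \<phi> p\<bar>)" using iT i\<phi> by simp
      show "integrable Leb_T2 (\<lambda>p. e)"
        by (rule finite_measure.integrable_const[OF finite_measure_Leb_T2])
      show "\<bar>T p - \<phi> p\<bar> \<le> e" if "p \<in> space Leb_T2" for p
        using T(2)[of p] that by (simp add: abs_minus_commute less_imp_le)
    qed
    finally have ce: "\<bar>c\<bar> \<le> e" by (simp add: measure_Leb_T2)
    have "AE p in Leb_T2. p \<in> T2" by (rule AE_I2) simp
    with c show ?thesis
    proof eventually_elim
      case (elim p)
      have "\<forall>\<^sub>F N in sequentially. \<bar>birkhoff_avg f T N p - c\<bar> < e"
        using elim(1) e by (simp add: tendsto_iff dist_real_def)
      then show ?case
      proof eventually_elim
        case (elim N)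
        have "birkhoff_avg f \<phi> N p = birkhoff_avg f T N p + birkhoff_avg f (\<lambda>p. \<phi> p - T p) N p"
          unfolding birkhoff_avg_add[symmetric] by simp
        moreover have "\<bar>birkhoff_avg f (\<lambda>p. \<phi> p - T p) N p\<bar> \<le> 2 * e"
          by (rule abs_birkhoff_avg_le[OF _ \<open>p \<in> T2\<close>]) (use T(2) in \<open>auto intro: less_imp_le\<close>)
        ultimately show ?case using elim ce by linarith
      qed
    qed
  qed
  have "AE p in Leb_T2. \<forall>m. \<forall>\<^sub>F N in sequentially. \<bar>birkhoff_avg f \<phi> N p\<bar> < 4 * (1 / real (Suc m))"
    unfolding AE_all_countable by (intro allI near) simp
  then show ?thesis
  proof eventually_elim
    case (elim p)
    show ?case
    proof (rule tendstoI)
      fix e :: real assume "0 < e"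
      then obtain m where m: "1 / real (Suc m) < e / 4"
        using reals_Archimedean[of "e / 4"] by (auto simp: inverse_eq_divide)
      show "\<forall>\<^sub>F N in sequentially. dist (birkhoff_avg f \<phi> N p) 0 < e"
        using elim[rule_format, of m] by eventually_elim (use m in simp)
    qed
  qed
qed

lemma birkhoff_avg_tendsto_L2:
  assumes m: "\<phi> \<in> borel_measurable Leb_T2" and b: "\<And>p. p \<in> T2 \<Longrightarrow> \<bar>\<phi> p\<bar> \<le> b"
    and lim: "AE p in Leb_T2. (\<lambda>N. birkhoff_avg f \<phi> N p) \<longlonglongrightarrow> 0"
  shows "tendsto_L2 Leb_T2 (birkhoff_avg f \<phi>) (\<lambda>_. 0)"
proof -
  have sq: "(birkhoff_avg f \<phi> N p)\<^sup>2 \<le> (2 * b)\<^sup>2" if "p \<in> T2" for N p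
    using power_mono[OF abs_birkhoff_avg_le[OF b that], where n = 2] by simp
  have meas: "(\<lambda>p. (birkhoff_avg f \<phi> N p)\<^sup>2) \<in> borel_measurable Leb_T2" for N
    by (intro borel_measurable_power measurable_birkhoff_avg m)
  have "(\<lambda>N. \<integral>p. (birkhoff_avg f \<phi> N p)\<^sup>2 \<partial>Leb_T2) \<longlonglongrightarrow> (\<integral>p. 0 \<partial>Leb_T2)"
  proof (rule integral_dominated_convergence[where w = "\<lambda>_. (2 * b)\<^sup>2"])
    show "integrable Leb_T2 (\<lambda>_. (2 * b)\<^sup>2)"
      by (rule finite_measure.integrable_const[OF finite_measure_Leb_T2])
    show "AE p in Leb_T2. norm ((birkhoff_avg f \<phi> N p)\<^sup>2) \<le> (2 * b)\<^sup>2" for N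
      using sq by (intro AE_I2) simp
    show "AE p in Leb_T2. (\<lambda>N. (birkhoff_avg f \<phi> N p)\<^sup>2) \<longlonglongrightarrow> 0"
      using lim
    proof eventually_elim
      case (elim p)
      from tendsto_power[OF elim, where n = 2] show ?case by simp
    qed
  qed (auto intro: meas)
  from tendsto_real_sqrt[OF this]
  have "(\<lambda>N. sqrt (\<integral>p. (birkhoff_avg f \<phi> N p)\<^sup>2 \<partial>Leb_T2)) \<longlonglongrightarrow> 0" by simp
  moreover have "integrable Leb_T2 (\<lambda>p. (birkhoff_avg f \<phi> N p)\<^sup>2)" for N
    by (rule integrable_Leb_T2[OF meas]) (use sq in auto)
  ultimately show ?thesis
    using measurable_birkhoff_avg[OF m] by (simp add: tendsto_L2_def)
qed

end

text \<open>The exponent is at most \<open>1/7\<close>, so the hypothesis even gives \<open>L N \<ge> N ^ 14\<close>; the twelfth power is what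
  is used.\<close>

lemma fourth_root_growth:
  fixes L :: "nat \<Rightarrow> real"
  assumes \<alpha>: "0 < \<alpha>" "\<alpha> \<le> 1" and pos: "\<And>n. 1 \<le> n \<Longrightarrow> 0 < L n"
    and lim: "(\<lambda>N. real N ^ 2 * L N powr (- (\<alpha> / (3 * \<alpha> + 4)))) \<longlonglongrightarrow> 0"
  shows "\<forall>\<^sub>F N in sequentially. real N ^ 3 \<le> root 4 (L N)"
proof -
  define \<beta> where "\<beta> = \<alpha> / (3 * \<alpha> + 4)"
  have \<beta>: "0 < \<beta>" "\<beta> * 7 \<le> 1" using \<alpha> by (auto simp: \<beta>_def field_simps)
  have "\<forall>\<^sub>F N in sequentially. real N ^ 2 * L N powr (- \<beta>) < 1"
    using order_tendstoD(2)[OF lim zero_less_one] by (simp add: \<beta>_def)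
  then show ?thesis
    using eventually_ge_at_top[of 1]
  proof eventually_elim
    case (elim N)
    have N: "1 \<le> real N" and L: "0 < L N" using elim pos by auto
    have "real N ^ 2 \<le> L N powr \<beta>"
      using elim(1) L by (simp add: powr_minus field_simps)
    then have "(real N ^ 2) powr (1 / \<beta>) \<le> (L N powr \<beta>) powr (1 / \<beta>)"
      using \<beta> by (intro powr_mono2) auto
    also have "\<dots> = L N" using \<beta> L by (simp add: powr_powr)
    finally have "(real N ^ 2) powr (1 / \<beta>) \<le> L N" .
    moreover have "real N ^ 12 \<le> (real N ^ 2) powr (1 / \<beta>)"
    proof -
      have "real N ^ 12 = (real N ^ 2) powr 6"
        using N by (simp add: powr_numeral flip: power_mult)
      also have "\<dots> \<le> (real N ^ 2) powr (1 / \<beta>)"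
        using N \<beta> by (intro powr_mono) (auto simp: field_simps one_le_power)
      finally show ?thesis .
    qed
    ultimately have "(real N ^ 3) ^ 4 \<le> L N" by (simp flip: power_mult)
    then have "root 4 ((real N ^ 3) ^ 4) \<le> root 4 (L N)" by (intro real_root_le_mono) auto
    moreover have "root 4 ((real N ^ 3) ^ 4) = real N ^ 3" by (rule real_root_power_cancel) auto
    ultimately show ?case by (simp only:)
  qed
qed

theorem theorem1:
  fixes \<alpha> K0 K1 :: real and M0 :: nat
  assumes "0 < \<alpha>" and "\<alpha> \<le> 1" and "0 < K0" and "0 < K1"
  shows "\<exists>L0>0. \<forall>(L :: nat \<Rightarrow> real) (f :: nat \<Rightarrow> real \<Rightarrow> real) (\<phi> :: real \<times> real \<Rightarrow> real).
    (\<forall>n\<ge>1. 0 < L n) \<longrightarrow> mono_on {1..} L \<longrightarrow> L0 \<le> L 1 \<longrightarrow>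
    (\<forall>n\<ge>1. admissible K0 K1 M0 (L n) (f n)) \<longrightarrow>
    Holder_T2 \<alpha> \<phi> \<longrightarrow> (\<integral>p. \<phi> p \<partial>Leb_T2) = 0 \<longrightarrow>
      (((\<lambda>N. real N ^ 2 * L N powr (- (\<alpha> / (3 * \<alpha> + 4)))) \<longlonglongrightarrow> 0) \<longrightarrow>
         tendsto_L2 Leb_T2 (birkhoff_avg f \<phi>) (\<lambda>_. 0)) \<and>
      ((\<exists>\<epsilon>>0. (\<lambda>N. real N powr (4 + \<epsilon>) * L N powr (- (\<alpha> / (3 * \<alpha> + 4)))) \<longlonglongrightarrow> 0) \<longrightarrow>
         (AE p in Leb_T2. (\<lambda>N. birkhoff_avg f \<phi> N p) \<longlonglongrightarrow> 0))"
\<comment> \<open>The sizes that the parameters must reach depend on the frequencies of the approximating waves. They are reached at some time because \<open>L N\<close> tends to infinity, so the witness for \<open>L0\<close> can be arbitrary.\<close>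
proof (intro exI[of _ 1] conjI allI impI)
  fix L :: "nat \<Rightarrow> real" and f :: "nat \<Rightarrow> real \<Rightarrow> real" and \<phi> :: "real \<times> real \<Rightarrow> real"
  assume pos: "\<forall>n\<ge>1. 0 < L n" and mono: "mono_on {1..} L"
    and adm: "\<forall>n\<ge>1. admissible K0 K1 M0 (L n) (f n)"
    and H: "Holder_T2 \<alpha> \<phi>" and mean: "(\<integral>p. \<phi> p \<partial>Leb_T2) = 0"
  note cont = Holder_T2D(1)[OF H assms(1)] and per = Holder_T2D(2)[OF H assms(1)]
  have fm: "f k \<in> borel_measurable borel" if "1 \<le> k" for k
    using adm that by (intro borel_measurable_continuous_onI admissible_continuous(1)) auto
  have ae: "AE p in Leb_T2. (\<lambda>N. birkhoff_avg f \<phi> N p) \<longlonglongrightarrow> 0"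
    if lim: "(\<lambda>N. real N ^ 2 * L N powr (- (\<alpha> / (3 * \<alpha> + 4)))) \<longlonglongrightarrow> 0"
  proof (rule AE_birkhoff_avg[OF fm _ cont per mean])
    fix a b :: int and \<theta> :: real assume ab: "(a, b) \<noteq> (0, 0)"
    show "AE p in Leb_T2. (\<lambda>N. birkhoff_avg f (wave a b \<theta>) N p) \<longlonglongrightarrow> 0"
    proof (rule AE_birkhoff_avg_wave[OF _ assms(3,4) _ _ ab])
      show "admissible K0 K1 M0 (root 4 (L k) ^ 4) (f k)" if "1 \<le> k" for k
        using adm pos that by (simp add: less_imp_le)
      show "mono_on {1..} (\<lambda>k. root 4 (L k))"
        using mono by (auto simp: mono_on_def)
      show "\<forall>\<^sub>F k in sequentially. real k ^ 3 \<le> root 4 (L k)"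
        by (rule fourth_root_growth[OF assms(1,2) _ lim]) (use pos in auto)
    qed
  qed
  show "tendsto_L2 Leb_T2 (birkhoff_avg f \<phi>) (\<lambda>_. 0)"
    if "(\<lambda>N. real N ^ 2 * L N powr (- (\<alpha> / (3 * \<alpha> + 4)))) \<longlonglongrightarrow> 0"
  proof -
    obtain b where "\<And>p. \<bar>\<phi> p\<bar> \<le> b" using periodic2_bounded[OF cont per] by blast
    then show ?thesis
      by (intro birkhoff_avg_tendsto_L2 fm ae that
          measurable_Leb_T2[OF borel_measurable_continuous_onI[OF cont]])
  qed
  show "AE p in Leb_T2. (\<lambda>N. birkhoff_avg f \<phi> N p) \<longlonglongrightarrow> 0"
    if ex: "\<exists>\<epsilon>>0. (\<lambda>N. real N powr (4 + \<epsilon>) * L N powr (- (\<alpha> / (3 * \<alpha> + 4)))) \<longlonglongrightarrow> 0"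
  \<comment> \<open>The growth condition of (b) is the stronger one.\<close>
  proof (rule ae)
    obtain \<epsilon> where \<epsilon>: "0 < \<epsilon>"
      and lim: "(\<lambda>N. real N powr (4 + \<epsilon>) * L N powr (- (\<alpha> / (3 * \<alpha> + 4)))) \<longlonglongrightarrow> 0"
      using ex by blast
    show "(\<lambda>N. real N ^ 2 * L N powr (- (\<alpha> / (3 * \<alpha> + 4)))) \<longlonglongrightarrow> 0"
    proof (rule Lim_null_comparison[OF _ lim])
      show "\<forall>\<^sub>F N in sequentially. norm (real N ^ 2 * L N powr (- (\<alpha> / (3 * \<alpha> + 4))))
          \<le> real N powr (4 + \<epsilon>) * L N powr (- (\<alpha> / (3 * \<alpha> + 4)))"
        using eventually_ge_at_top[of 1]
      proof eventually_elim
        case (elim N)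
        have "real N ^ 2 = real N powr 2" using elim by (simp add: powr_numeral)
        also have "\<dots> \<le> real N powr (4 + \<epsilon>)" using elim \<epsilon> by (intro powr_mono) auto
        finally show ?case by (simp add: abs_mult mult_right_mono)
      qed
    qed
  qed
qed simp

end
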